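(* The Longest Queue Drop algorithm (LQD) is $1.6918$-competitive for throughput maximization in shared-memory switches with unit-value packets. That is, for every buffer size $M\in\mathbb{N}$, every number $N\in\mathbb{N}$ of output ports, every (finite) input instance $I$, and every way of breaking ties in LQD (even adversarially controlled), the number $\mathrm{OPT}(I)$ of packets transmitted by an optimal offline algorithm and the number $\mathrm{LQD}(I)$ of packets transmitted by LQD satisfy $$\mathrm{OPT}(I)\le 1.6918\cdot \mathrm{LQD}(I).$$
   Context: A shared-memory switch has a buffer of capacity $M\in\mathbb{N}$ packets, one input port and $N\in\mathbb{N}$ output ports, each output port having its own queue. Time is slotted in steps $0,1,2,\dots$. In each time step an arbitrary finite sequence of unit-value packets arrives, each packet being destined to one specified output port (only finitely many packets arrive overall). Each arriving packet is either accepted (stored in the queue of its output port) or irrevocably evicted; previously accepted packets may also be irrevocably evicted. At most $M$ packets in total may be stored at any time. At the end of each time step, every output port whose queue is nonempty transmits one packet of its queue. The goal is to maximize the total number of transmitted packets. Longest Queue Drop (LQD) is the online algorithm that processes arriving packets one by one: it always accepts the incoming packet, and if this makes the total number of stored packets exceed $M$, it evicts one packet from a queue that is currently longest (possibly the incoming packet itself), breaking ties arbitrarily. An online algorithm is $c$-competitive ($c\ge1$) if on every instance the number of packets transmitted by an optimal offline algorithm (which knows the whole arrival sequence in advance) is at most $c$ times the number of packets transmitted by the algorithm. *)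

theory Defs
  imports Complex_Main
begin

text \<open>
  Output ports are the numbers below \<open>N\<close>. Packets have unit value, so packets stored for the same
  port are interchangeable, and a buffer content is given by the lengths of the queues.
\<close>

type_synonym buffer = "nat \<Rightarrow> nat"

text \<open>
  An instance gives, for each time step, the destinations of the packets arriving in that step, in
  order of arrival.
\<close>

type_synonym arrivals = "nat \<Rightarrow> nat list"

definition valid_instance :: "nat \<Rightarrow> arrivals \<Rightarrow> bool" where
  "valid_instance N I \<longleftrightarrow> finite {t. I t \<noteq> []} \<and> (\<forall>t. set (I t) \<subseteq> {..<N})"

definition occupancy :: "nat \<Rightarrow> buffer \<Rightarrow> nat" where
  "occupancy N q = (\<Sum>i<N. q i)"

definition enqueue :: "nat \<Rightarrow> buffer \<Rightarrow> buffer" where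
  "enqueue p q = q(p := Suc (q p))"

definition dequeue :: "nat \<Rightarrow> buffer \<Rightarrow> buffer" where
  "dequeue p q = q(p := q p - 1)"

definition transmit :: "buffer \<Rightarrow> buffer" where
  "transmit q = (\<lambda>i. q i - 1)"

text \<open>
  Processing one arriving packet. The order on buffers is pointwise: an offline algorithm may evict
  the arriving packet as well as any packets already stored.
\<close>

definition offline_arrival :: "nat \<Rightarrow> nat \<Rightarrow> buffer \<Rightarrow> nat \<Rightarrow> buffer \<Rightarrow> bool" where
  "offline_arrival N M q p q' \<longleftrightarrow> q' \<le> enqueue p q \<and> occupancy N q' \<le> M"

definition lqd_arrival :: "nat \<Rightarrow> nat \<Rightarrow> buffer \<Rightarrow> nat \<Rightarrow> buffer \<Rightarrow> bool" where
  "lqd_arrival N M q p q' \<longleftrightarrow>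
    (if occupancy N (enqueue p q) \<le> M then q' = enqueue p q
     else \<exists>j<N. (\<forall>i<N. enqueue p q i \<le> enqueue p q j) \<and> q' = dequeue j (enqueue p q))"

inductive process ::
  "(buffer \<Rightarrow> nat \<Rightarrow> buffer \<Rightarrow> bool) \<Rightarrow> buffer \<Rightarrow> nat list \<Rightarrow> buffer \<Rightarrow> bool"
  for arrive :: "buffer \<Rightarrow> nat \<Rightarrow> buffer \<Rightarrow> bool" where
  Nil: "process arrive q [] q"
| Cons: "arrive q p q' \<Longrightarrow> process arrive q' ps q'' \<Longrightarrow> process arrive q (p # ps) q''"

text \<open>The final inequality permits evictions also in time steps without arrivals.\<close>

definition offline_phase :: "nat \<Rightarrow> nat \<Rightarrow> buffer \<Rightarrow> nat list \<Rightarrow> buffer \<Rightarrow> bool" where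
  "offline_phase N M q ps q' \<longleftrightarrow> (\<exists>r. process (offline_arrival N M) q ps r \<and> q' \<le> r)"

definition lqd_phase :: "nat \<Rightarrow> nat \<Rightarrow> buffer \<Rightarrow> nat list \<Rightarrow> buffer \<Rightarrow> bool" where
  "lqd_phase N M = process (lqd_arrival N M)"

text \<open>
  In a run \<open>b\<close>, \<open>b t\<close> is the buffer in time step \<open>t\<close> after all arrivals of that step have been
  processed and immediately before transmission.
\<close>

definition is_run ::
  "(buffer \<Rightarrow> nat list \<Rightarrow> buffer \<Rightarrow> bool) \<Rightarrow> arrivals \<Rightarrow> (nat \<Rightarrow> buffer) \<Rightarrow> bool" where
  "is_run phase I b \<longleftrightarrow>
    phase (\<lambda>_. 0) (I 0) (b 0) \<and> (\<forall>t. phase (transmit (b t)) (I (Suc t)) (b (Suc t)))"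

abbreviation offline_run :: "nat \<Rightarrow> nat \<Rightarrow> arrivals \<Rightarrow> (nat \<Rightarrow> buffer) \<Rightarrow> bool" where
  "offline_run N M \<equiv> is_run (offline_phase N M)"

text \<open>
  LQD is nondeterministic in its choice of a longest queue; its runs are exactly those obtained from
  arbitrary, even adversarial, tie breaking.
\<close>

abbreviation lqd_run :: "nat \<Rightarrow> nat \<Rightarrow> arrivals \<Rightarrow> (nat \<Rightarrow> buffer) \<Rightarrow> bool" where
  "lqd_run N M \<equiv> is_run (lqd_phase N M)"

definition transmissions :: "nat \<Rightarrow> (nat \<Rightarrow> buffer) \<Rightarrow> (nat \<times> nat) set" where
  "transmissions N b = {(t, i). i < N \<and> 0 < b t i}"

definition throughput :: "nat \<Rightarrow> (nat \<Rightarrow> buffer) \<Rightarrow> nat" where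
  "throughput N b = card (transmissions N b)"

definition opt :: "nat \<Rightarrow> nat \<Rightarrow> arrivals \<Rightarrow> nat" where
  "opt N M I = Max {throughput N b |b. offline_run N M I b}"


text \<open>
  The cardinality and the maximum above are taken over finite sets (nonempty for the maximum), and
  LQD runs exist and are offline runs.
\<close>

lemma process_offline_occupancy:
  assumes "process (offline_arrival N M) q ps q'"
  shows "occupancy N q' \<le> occupancy N q + length ps"
  using assms
proof induction
  case (Cons q p q' ps q'')
  have "occupancy N q' \<le> occupancy N (enqueue p q)"
    using Cons.hyps(1) by (auto simp: offline_arrival_def occupancy_def le_fun_def intro: sum_mono)
  also have "\<dots> \<le> (\<Sum>i<N. q i + (if i = p then 1 else 0))"
    unfolding occupancy_def enqueue_def by (intro sum_mono) auto
  also have "\<dots> \<le> occupancy N q + 1"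
    by (simp add: sum.distrib occupancy_def)
  finally show ?case using Cons.IH by simp
qed simp

lemma offline_phase_occupancy:
  assumes "offline_phase N M q ps q'"
  shows "occupancy N q' \<le> occupancy N q + length ps"
proof -
  obtain r where r: "process (offline_arrival N M) q ps r" "q' \<le> r"
    using assms by (auto simp: offline_phase_def)
  have "occupancy N q' \<le> occupancy N r"
    using r(2) by (auto simp: occupancy_def le_fun_def intro: sum_mono)
  then show ?thesis using process_offline_occupancy[OF r(1)] by simp
qed

lemma occupancy_transmit:
  "occupancy N (transmit q) + card {i. i < N \<and> 0 < q i} = occupancy N q"
proof -
  have "card {i. i < N \<and> 0 < q i} = (\<Sum>i<N. if 0 < q i then 1 else 0)"
    by (simp add: sum.If_cases Int_def)
  then have "occupancy N (transmit q) + card {i. i < N \<and> 0 < q i}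
      = (\<Sum>i<N. (q i - 1) + (if 0 < q i then 1 else 0))"
    by (simp add: occupancy_def transmit_def sum.distrib)
  also have "\<dots> = occupancy N q"
    unfolding occupancy_def by (intro sum.cong) auto
  finally show ?thesis .
qed

lemma offline_run_balance:
  assumes "offline_run N M I b"
  shows "occupancy N (b t) + (\<Sum>s<t. card {i. i < N \<and> 0 < b s i}) \<le> (\<Sum>s\<le>t. length (I s))"
proof (induction t)
  case 0
  have "offline_phase N M (\<lambda>_. 0) (I 0) (b 0)" using assms by (simp add: is_run_def)
  from offline_phase_occupancy[OF this] show ?case by (simp add: occupancy_def)
next
  case (Suc t)
  have "offline_phase N M (transmit (b t)) (I (Suc t)) (b (Suc t))"
    using assms by (simp add: is_run_def)
  from offline_phase_occupancy[OF this] show ?case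
    using Suc.IH occupancy_transmit[of N "b t"] by simp
qed

lemma offline_run_transmissions:
  assumes "valid_instance N I" and run: "offline_run N M I b"
  shows "finite (transmissions N b)"
    and "throughput N b \<le> (\<Sum>t | I t \<noteq> []. length (I t))" (is "_ \<le> ?K")
proof -
  have fin: "finite {t. I t \<noteq> []}" using assms(1) by (simp add: valid_instance_def)
  have "finite (transmissions N b) \<and> card (transmissions N b) \<le> ?K"
  proof (rule finite_if_finite_subsets_card_bdd)
    fix G assume G: "G \<subseteq> transmissions N b" "finite G"
    obtain T where T: "\<forall>s\<in>fst ` G. s < T"
      using finite_nat_set_iff_bounded G(2) by (metis finite_imageI)
    have "G \<subseteq> Sigma {..<T} (\<lambda>s. {i. i < N \<and> 0 < b s i})"
      using G(1) T by (force simp: transmissions_def)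
    then have "card G \<le> card (Sigma {..<T} (\<lambda>s. {i. i < N \<and> 0 < b s i}))"
      by (intro card_mono) auto
    also have "\<dots> = (\<Sum>s<T. card {i. i < N \<and> 0 < b s i})" by simp
    also have "\<dots> \<le> (\<Sum>s\<le>T. length (I s))" using offline_run_balance[OF run, of T] by simp
    also have "\<dots> = (\<Sum>s\<in>{..T} \<inter> {t. I t \<noteq> []}. length (I s))"
      by (intro sum.mono_neutral_right) auto
    also have "\<dots> \<le> ?K" using fin by (intro sum_mono2) auto
    finally show "card G \<le> ?K" .
  qed
  then show "finite (transmissions N b)" "throughput N b \<le> ?K" by (auto simp: throughput_def)
qed

lemma finite_offline_throughputs:
  assumes "valid_instance N I"
  shows "finite {throughput N b |b. offline_run N M I b}"
  by (rule finite_subset[of _ "{..(\<Sum>t | I t \<noteq> []. length (I t))}"])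
    (use offline_run_transmissions(2)[OF assms] in auto)

lemma lqd_arrival_offline:
  assumes "lqd_arrival N M q p q'" "occupancy N q \<le> M"
  shows "offline_arrival N M q p q'"
proof (cases "occupancy N (enqueue p q) \<le> M")
  case True
  then show ?thesis using assms by (simp add: lqd_arrival_def offline_arrival_def)
next
  case False
  then obtain j where j: "j < N" "\<forall>i<N. enqueue p q i \<le> enqueue p q j"
      "q' = dequeue j (enqueue p q)"
    using assms(1) by (auto simp: lqd_arrival_def)
  have pos: "0 < enqueue p q j"
  proof (rule ccontr)
    assume "\<not> 0 < enqueue p q j"
    then have "occupancy N (enqueue p q) = 0" using j(2) by (simp add: occupancy_def)
    then show False using False by simp
  qed
  have "occupancy N (enqueue p q) \<le> (\<Sum>i<N. q i + (if i = p then 1 else 0))"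
    unfolding occupancy_def enqueue_def by (intro sum_mono) auto
  also have "\<dots> \<le> occupancy N q + 1" by (simp add: sum.distrib occupancy_def)
  finally have "occupancy N (enqueue p q) \<le> M + 1" using assms(2) by simp
  moreover have "occupancy N q' < occupancy N (enqueue p q)"
    unfolding occupancy_def using j pos by (intro sum_strict_mono_ex1) (auto simp: dequeue_def)
  moreover have "q' \<le> enqueue p q" using j(3) by (auto simp: dequeue_def le_fun_def)
  ultimately show ?thesis by (simp add: offline_arrival_def)
qed

lemma process_lqd_offline:
  assumes "process (lqd_arrival N M) q ps q'" "occupancy N q \<le> M"
  shows "process (offline_arrival N M) q ps q' \<and> occupancy N q' \<le> M"
  using assms
proof induction
  case (Cons q p q' ps q'')
  from lqd_arrival_offline[OF Cons.hyps(1) Cons.prems] Cons.IH show ?case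
    by (auto simp: offline_arrival_def intro: process.Cons)
qed (auto intro: process.Nil)

lemma lqd_run_offline:
  assumes "lqd_run N M I b"
  shows "offline_run N M I b"
proof -
  have p: "process (lqd_arrival N M) (\<lambda>_. 0) (I 0) (b 0)"
      "\<And>t. process (lqd_arrival N M) (transmit (b t)) (I (Suc t)) (b (Suc t))"
    using assms by (auto simp: is_run_def lqd_phase_def)
  have tr: "occupancy N (transmit q) \<le> M" if "occupancy N q \<le> M" for q
    using that occupancy_transmit[of N q] by simp
  have occ: "occupancy N (b t) \<le> M" for t
  proof (induction t)
    case 0
    show ?case using process_lqd_offline[OF p(1)] by (simp add: occupancy_def)
  next
    case (Suc t)
    show ?case using process_lqd_offline[OF p(2) tr[OF Suc.IH]] by simp
  qed
  have "offline_phase N M (\<lambda>_. 0) (I 0) (b 0)"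
    using process_lqd_offline[OF p(1)] by (auto simp: offline_phase_def occupancy_def)
  moreover have "offline_phase N M (transmit (b t)) (I (Suc t)) (b (Suc t))" for t
    using process_lqd_offline[OF p(2) tr[OF occ]] by (auto simp: offline_phase_def)
  ultimately show ?thesis by (simp add: is_run_def)
qed

lemma lqd_arrival_exists:
  assumes "p < N"
  shows "\<exists>q'. lqd_arrival N M q p q'"
proof -
  have "Max (enqueue p q ` {..<N}) \<in> enqueue p q ` {..<N}"
    using assms by (intro Max_in) auto
  then obtain j where "j < N" "Max (enqueue p q ` {..<N}) = enqueue p q j" by auto
  moreover then have "\<forall>i<N. enqueue p q i \<le> enqueue p q j"
    by (metis Max_ge finite_imageI finite_lessThan imageI lessThan_iff)
  ultimately show ?thesis unfolding lqd_arrival_def by auto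
qed

lemma lqd_phase_exists:
  assumes "set ps \<subseteq> {..<N}"
  shows "\<exists>q'. lqd_phase N M q ps q'"
  using assms
proof (induction ps arbitrary: q)
  case Nil
  show ?case unfolding lqd_phase_def by (blast intro: process.Nil)
next
  case (Cons p ps)
  then show ?case
    using lqd_arrival_exists[of p N M q] unfolding lqd_phase_def
    by (fastforce intro: process.Cons)
qed

lemma lqd_run_exists:
  assumes "valid_instance N I"
  shows "\<exists>b. lqd_run N M I b"
proof -
  have ex: "\<exists>q'. lqd_phase N M q (I t) q'" for q t
    using assms lqd_phase_exists[of "I t" N M q] by (simp add: valid_instance_def)
  define next_buffer where "next_buffer q t = (SOME q'. lqd_phase N M q (I t) q')" for q t
  have nb: "lqd_phase N M q (I t) (next_buffer q t)" for q t
    unfolding next_buffer_def using ex by (rule someI_ex)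
  define b where "b = rec_nat (next_buffer (\<lambda>_. 0) 0) (\<lambda>t q. next_buffer (transmit q) (Suc t))"
  have "b 0 = next_buffer (\<lambda>_. 0) 0" "\<And>t. b (Suc t) = next_buffer (transmit (b t)) (Suc t)"
    by (simp_all add: b_def)
  then have "lqd_run N M I b" using nb by (simp add: is_run_def)
  then show ?thesis by blast
qed

lemma offline_throughputs_nonempty:
  assumes "valid_instance N I"
  shows "{throughput N b |b. offline_run N M I b} \<noteq> {}"
proof -
  obtain b where "lqd_run N M I b" using lqd_run_exists[OF assms] by blast
  from lqd_run_offline[OF this] have "throughput N b \<in> {throughput N b |b. offline_run N M I b}"
    by (intro CollectI exI[of _ b] conjI refl)
  then show ?thesis by (rule ex_in_conv[THEN iffD1, OF exI])
qed

end

theory Submission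
  imports Defs
begin

text \<open>
  The advantage of an offline run over LQD is charged to the transmissions of LQD. Suppose the offline
  run transmits from a port at which LQD is empty. Trace this back to the last step \<open>u\<close> in which LQD
  evicted a packet from that port: at every step in between, the offline queue there exceeds the LQD
  queue by at least the number of such transmissions to come. Let \<open>d M\<close> be the total surplus of the
  offline queues over the LQD queues in a step. Each LQD transmission of that step pays
  \<open>3 (2 - d) / M\<close> to every surplus packet and \<open>1 / M\<close> to every packet that both runs store for the
  same port; this amounts to at most \<open>3 (2 - d) d + (1 - d) \<le> 37/12\<close>, with equality at \<open>d = 5/6\<close>.
  A transmission which only LQD makes pays up to \<open>9/2\<close> more.

  What has to be shown is that every transmission of the offline run alone receives \<open>9/2\<close> on average,
  so that \<open>9/2 (OPT - LQD) \<le> 37/12 LQD\<close>, hence \<open>OPT \<le> 91/54 LQD\<close>. When LQD evicts in step \<open>u\<close>, its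
  buffer is full and all queues have length at most \<open>l\<close>, so from \<open>u\<close> to \<open>u + l\<close> it transmits at least
  \<open>M\<close> packets. These alone pay \<open>3\<close>; the rest comes from small \<open>d\<close>: an
  LQD queue that runs empty without further evictions has, up to transmissions made by LQD alone, an
  offline counterpart at least as long, since the surplus cannot grow in the meantime. Further
  evictions are treated by induction on the later overflow, which either suffices or happens to
  queues that are longer than those at \<open>u\<close> and then supply the missing income themselves.
\<close>

section \<open>Inequalities for real numbers\<close>

text \<open>For nonnegative \<open>r\<close> this is the integral of \<open>max 0 (1 - s)\<close>
  for \<open>s\<close> from 0 to \<open>r\<close>; it stays at its maximum 1/2 from
  \<open>r = 1\<close> on. \<open>1 + nu r\<close> will be the income guaranteed to a surplus packet
  in units of \<open>M\<^sup>2\<close>.\<close>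

definition nu :: "real \<Rightarrow> real" where
  "nu r = 1/2 - (max 0 (1 - r))\<^sup>2 / 2"

lemma nu_min: "nu r = min r 1 - (min r 1)\<^sup>2 / 2"
  by (auto simp: nu_def max_def min_def power2_eq_square field_simps)

lemma nu_le: "nu r \<le> 1/2"
  by (simp add: nu_def)

text \<open>Used for an overflow at \<open>u\<close> with queues of length \<open>l\<close>, and a later one at \<open>v\<close> with queues of length
  \<open>l'\<close>: \<open>h = t - u\<close>, \<open>x = v - u\<close>, \<open>y\<close> is the length of the queue evicted from at \<open>v\<close>, and \<open>a M\<close> is the
  number of packets transmitted from \<open>u\<close> to \<open>v\<close>.\<close>

lemma join_loss:
  fixes l l' h x y :: nat and a \<rho> \<rho>' :: real
  defines "\<rho> \<equiv> real (h + 1) / l - 1"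
  defines "\<rho>' \<equiv> real (h - x + 1) / l' - 1"
  assumes l: "1 \<le> l" "1 \<le> l'" and x: "1 \<le> x" "x \<le> l" "x \<le> h" and l': "l' \<le> h - x"
    and y: "l' \<le> y + 1" "y \<le> l'" and a: "real x / l \<le> a" and bad: "a + nu \<rho>' < nu \<rho>"
  shows "l < l'"
    and "l * (1 + min \<rho> 1) - (x + y + a + y / (2 * l')) \<le> y * (min \<rho> 1 - a) + x * (1 - min \<rho> 1)"
proof -
  define m where "m = min \<rho> 1"
  define d where "d = m - \<rho>'"
  define g where "g = l * (\<rho> - m)"
  define W where "W = l' * d + g"
  have apos: "0 < a" 
  proof -
    have "0 < real x / l" using x l by simp
    then show ?thesis using a by linarith
  qed
  have lp: "0 < real l" "0 < real l'" using l by auto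
  have \<rho>'1: "\<rho>' < 1"
  proof (rule ccontr)
    assume "\<not> \<rho>' < 1"
    then have "nu \<rho>' = 1/2" by (simp add: nu_def)
    then show False using bad apos nu_le[of \<rho>] by simp
  qed
  have m1: "m \<le> 1" by (simp add: m_def)
  have \<rho>'l: "1 / l' \<le> \<rho>'" using l' lp by (simp add: \<rho>'_def field_simps)
  have \<rho>'0: "0 < \<rho>'" 
  proof -
    have "0 < 1 / real l'" using lp by simp
    then show ?thesis using \<rho>'l by linarith
  qed
  have nu1: "nu \<rho> = m - m\<^sup>2/2" by (simp add: nu_min m_def)
  have nu2: "nu \<rho>' = \<rho>' - \<rho>'\<^sup>2/2" using \<rho>'1 by (simp add: nu_min)
  \<comment> \<open>\<open>nu\<close> is constant beyond 1, and its mean slope between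
    \<open>\<rho>'\<close> and \<open>m\<close> is \<open>1 - m + d/2\<close>.\<close>
  have ad: "a < d * (1 - m + d/2)"
    using bad unfolding nu1 nu2 d_def by (simp add: power2_eq_square field_simps)
  have d0: "0 < d"
  proof (rule ccontr)
    assume "\<not> 0 < d"
    moreover have "0 \<le> 1 - m + d/2" using m1 \<rho>'1 by (simp add: d_def field_simps)
    ultimately have "d * (1 - m + d/2) \<le> 0" by (simp add: mult_nonpos_nonneg)
    with ad apos show False by simp
  qed
  have g0: "0 \<le> g" by (simp add: g_def m_def)
  have e1: "l' * (1 + \<rho>') = real h - x + 1" using x lp by (simp add: \<rho>'_def of_nat_diff)
  have e2: "l * (1 + \<rho>) = real h + 1" using lp by (simp add: \<rho>_def)
  \<comment> \<open>Both windows end at the same step; eliminating \<open>h\<close> from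
    \<open>e1\<close> and \<open>e2\<close> leaves an expression in the queue lengths,
    \<open>m\<close> and \<open>x\<close>.\<close>
  have W: "W = (real l' - l) * (1 + m) + x"
    using e1 e2 unfolding W_def g_def d_def by (simp add: algebra_simps)
  have m0: "0 < m" using d0 \<rho>'0 by (simp add: d_def)
  define p where "p = 1 - m + d/2"
  have p1: "p \<le> 1 - m/2 - 1/(2*l')" using \<rho>'l by (simp add: p_def d_def field_simps)
  have p0: "0 \<le> p" using m1 d0 by (simp add: p_def)
  have ple: "p \<le> 1" 
  proof -
    have "0 \<le> 1/(2 * real l')" by simp
    then show ?thesis using p1 m0 by linarith
  qed
  have ap: "a < d * p" using ad by (simp add: p_def)
  \<comment> \<open>\<open>nu\<close> has slope at most 1 here, so \<open>bad\<close> forces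
    \<open>a < d\<close>; but \<open>l' \<le> l\<close> would give
    \<open>d \<le> x / l \<le> a\<close>.\<close>
  show ll: "l < l'"
  proof (rule ccontr)
    assume "\<not> l < l'"
    then have ge: "real l' \<le> l" by simp
    have "l' * d \<le> W" using g0 by (simp add: W_def)
    also have "W \<le> x * (real l' / l)"
    proof -
      have "real x * (1 - l'/l) \<le> l * (1 - l'/l)" using x ge lp by (intro mult_right_mono) auto
      also have "\<dots> = real l - l'" using lp by (simp add: field_simps)
      also have "\<dots> \<le> (real l - l') * (1 + m)" using ge m0 by (simp add: algebra_simps)
      finally show ?thesis unfolding W by (simp add: algebra_simps)
    qed
    finally have "d \<le> x / l" using lp by (simp add: field_simps)
    then have "d \<le> a" using a by simp
    moreover have "d * p \<le> d" using d0 ple by (simp add: mult_left_le)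
    ultimately show False using ap by simp
  qed
  have L: "real l + 1 \<le> l'" using ll by linarith
  have Wg: "W \<ge> 2 + m"
  proof -
    have "1 * (1 + m) \<le> (real l' - l) * (1 + m)" using L m0 by (intro mult_right_mono) auto
    then show ?thesis unfolding W using x by simp
  qed
  have dW: "l' * d \<le> W" using g0 by (simp add: W_def)
  have l2: "2 \<le> real l'" using L l by linarith
  have eq: "l * (1 + m) = l' * (1 + m) + x - W" unfolding W by (simp add: algebra_simps)
  have ax: "0 \<le> x * (1 - m)" using m1 by simp
  have "l * (1 + m) - (x + y + a + y / (2 * l')) \<le> y * (m - a) + x * (1 - m)"
  \<comment> \<open>Only \<open>y = l'\<close> and \<open>y = l' - 1\<close> are possible. The first
    case needs just \<open>p \<le> 1\<close>, the second the sharper bound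
    \<open>p1\<close>.\<close>
  proof (cases "y = l'")
    case True
    have "(real l' - 1) * a \<le> l' * (d * p)" using ap l2 apos by (intro mult_mono) auto
    also have "\<dots> \<le> l' * d" using d0 ple lp by (intro mult_left_mono) (auto simp: mult_left_le)
    finally have "(real l' - 1) * a \<le> W" using dW by simp
    then show ?thesis unfolding eq using True ax lp by (simp add: algebra_simps)
  next
    case False
    then have yl: "real y = real l' - 1" using y by linarith
    have "(real l' - 2) * a \<le> (real l' - 2) * (d * p)" using ap l2 by (intro mult_left_mono) auto
    also have "\<dots> \<le> (l' * d) * p" using d0 p0 by (simp add: algebra_simps)
    also have "\<dots> \<le> W * p" using dW p0 by (rule mult_right_mono)
    finally have 1: "(real l' - 2) * a \<le> W * p" .
    have 2: "(2 + m) * (m/2 + 1/(2*l')) \<le> W * (1 - p)"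
      using Wg p1 m0 lp by (intro mult_mono) auto
    have 3: "1 - m \<le> x * (1 - m)" using m1 x by (simp add: mult_right_mono[of 1 "real x" "1-m", simplified])
    have 4: "m + m\<^sup>2/2 + (2+m)/(2*l') + (1 - m) - (1/2 + m + 1/(2*l')) = (1-m)\<^sup>2/2 + (1+m)/(2*l')"
      using lp by (simp add: power2_eq_square field_simps)
    have 5: "0 \<le> (1-m)\<^sup>2/2 + (1+m)/(2*l')" using m0 lp by simp
    have 6: "(2 + m) * (m/2 + 1/(2*l')) = m + m\<^sup>2/2 + (2+m)/(2*l')"
      using lp by (simp add: power2_eq_square field_simps)
    have "(real l' - 2) * a + 1 + m \<le> W + 1/2 - 1/(2*l') + x * (1 - m)"
    proof -
      have "W * (1 - p) = W - W * p" by (simp add: algebra_simps)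
      then show ?thesis using 1 2 3 4 5 6 by linarith
    qed
    moreover have "y / (2*l') = 1/2 - 1/(2*l')" unfolding yl using lp(2) by (simp add: diff_divide_distrib)
    moreover have "y * (m - a) = l' * m - l' * a - m + a" unfolding yl by algebra
    moreover have "(real l' - 2) * a = l' * a - 2 * a" "l' * (1 + m) = l' + l' * m"
      by algebra+
    ultimately show ?thesis using eq yl unfolding of_nat_add by linarith
  qed
  then show "l * (1 + min \<rho> 1) - (x + y + a + y / (2 * l')) \<le> y * (min \<rho> 1 - a) + x * (1 - min \<rho> 1)"
    by (simp add: m_def)
qed

text \<open>Telescoping: \<open>2 * k v * \<kappa> v - (k v)\<^sup>2\<close> is the loss of the
  square of \<open>\<kappa> v\<close> when \<open>k v\<close> is removed, after which
  \<open>j (Suc v)\<close> is added. To be used with \<open>stock\<close> for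
  \<open>\<kappa>\<close> and \<open>joining\<close> for \<open>j\<close>.\<close>

lemma square_sum:
  fixes \<kappa> k j :: "nat \<Rightarrow> real"
  assumes "\<And>v. u \<le> v \<Longrightarrow> v < t \<Longrightarrow> k v \<le> \<kappa> v" "\<And>v. 0 \<le> j v"
    and "\<And>v. u \<le> v \<Longrightarrow> Suc v < t \<Longrightarrow> \<kappa> v - k v + j (Suc v) \<le> \<kappa> (Suc v)"
    and "u \<le> m" "m < t"
  shows "(\<kappa> u)\<^sup>2 + (\<Sum>v\<in>{u..<m}. 2 * (\<kappa> v - k v) * j (Suc v) + (j (Suc v))\<^sup>2)
    \<le> (\<Sum>v\<in>{u..<m}. 2 * k v * \<kappa> v - (k v)\<^sup>2) + (\<kappa> m)\<^sup>2"
  using assms(4,5)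
proof (induction m rule: dec_induct)
  case (step m)
  have e: "0 \<le> \<kappa> m - k m" using assms(1)[of m] step by simp
  have "(\<kappa> m - k m + j (Suc m))\<^sup>2 \<le> (\<kappa> (Suc m))\<^sup>2"
    using assms(2)[of "Suc m"] assms(3)[of m] step e by (intro power_mono) auto
  then have "2 * (\<kappa> m - k m) * j (Suc m) + (j (Suc m))\<^sup>2 \<le> 2 * k m * \<kappa> m - (k m)\<^sup>2 - (\<kappa> m)\<^sup>2 + (\<kappa> (Suc m))\<^sup>2"
    by (simp add: power2_eq_square algebra_simps)
  with step show ?case by simp
qed simp

text \<open>Each term is at most the integral of the positive part of \<open>Z - s\<close> over an
  interval of length \<open>j v\<close>. The intervals are adjacent, so together they stay within a
  triangle with legs \<open>max 0 Z\<close>.\<close>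

lemma quadratic_greedy:
  fixes j :: "nat \<Rightarrow> real" and Z :: real
  assumes "\<And>v. 0 \<le> j v"
  shows "(\<Sum>v\<in>{u..<m}. j v * max 0 (Z - (\<Sum>s\<in>{u..<v}. j s)) - (j v)\<^sup>2/2) \<le> Z\<^sup>2/2"
proof (cases "u \<le> m")
  case True
  define S where "S v = (\<Sum>s\<in>{u..<v}. j s)" for v
  have "(\<Sum>v\<in>{u..<m}. j v * max 0 (Z - S v) - (j v)\<^sup>2/2) \<le> ((max 0 Z)\<^sup>2 - (max 0 (Z - S m))\<^sup>2)/2"
    using True
  proof (induction m rule: dec_induct)
    case (step m)
    define b where "b = max 0 (Z - S m)"
    have Sm: "S (Suc m) = S m + j m" using step by (simp add: S_def)
    have "j m * b - (j m)\<^sup>2/2 \<le> (b\<^sup>2 - (max 0 (Z - S (Suc m)))\<^sup>2)/2"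
    proof (cases "j m \<le> Z - S m")
      case True
      then have eq: "max 0 (Z - S (Suc m)) = b - j m" using assms[of m] by (auto simp: Sm b_def)
      show ?thesis unfolding eq by (simp add: power2_eq_square algebra_simps)
    next
      case False
      have "0 \<le> (b - j m)\<^sup>2" by simp
      then have "j m * b - (j m)\<^sup>2/2 \<le> b\<^sup>2/2" by (simp add: power2_eq_square algebra_simps)
      moreover have "max 0 (Z - S (Suc m)) = 0" using False by (simp add: Sm)
      ultimately show ?thesis by simp
    qed
    with step show ?case by (simp add: b_def field_simps)
  qed (simp add: S_def)
  also have "\<dots> \<le> (max 0 Z)\<^sup>2/2" by simp
  also have "\<dots> \<le> Z\<^sup>2/2" by (auto simp: max_def)
  finally show ?thesis by (simp add: S_def)
qed simp

lemma sum_triangle: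
  fixes b :: "nat \<Rightarrow> nat"
  shows "(\<Sum>s<m. (m - s) * b s) = (\<Sum>k<m. \<Sum>s<Suc k. b s)"
proof (induction m)
  case (Suc m)
  have "(\<Sum>s<m. (Suc m - s) * b s) = (\<Sum>s<m. (m - s) * b s + b s)"
    by (intro sum.cong) (auto simp: Suc_diff_le)
  then have "(\<Sum>s<Suc m. (Suc m - s) * b s) = (\<Sum>s<m. (m - s) * b s + b s) + b m"
    by simp
  also have "\<dots> = (\<Sum>k<m. \<Sum>s<Suc k. b s) + (\<Sum>s<m. b s) + b m" using Suc by (simp add: sum.distrib)
  finally show ?case by simp
qed simp

lemma sum_complement_squares:
  assumes "1 \<le> l"
  shows "(\<Sum>r\<in>{1..<l}. (1 - real r / l)\<^sup>2) \<le> (real l - 1) / 3"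
proof -
  have sq: "6 * (\<Sum>r<m. (real (m - r))\<^sup>2) = m * (real m + 1) * (2 * m + 1)" for m :: nat
  proof -
    have "(\<Sum>r<m. (real (m - r))\<^sup>2) = (\<Sum>r<m. (real (Suc r))\<^sup>2)"
      by (rule sum.reindex_bij_witness[of _ "\<lambda>r. m - Suc r" "\<lambda>r. m - Suc r"]) (auto simp: Suc_diff_Suc)
    also have "6 * \<dots> = m * (real m + 1) * (2 * m + 1)"
      by (induction m) (simp_all add: power2_eq_square algebra_simps)
    finally show ?thesis .
  qed
  have lp: "0 < real l" using assms by simp
  have "(\<Sum>r\<in>{1..<l}. (1 - real r / l)\<^sup>2) = (\<Sum>r\<in>{1..<l}. (real (l - r))\<^sup>2) / (real l)\<^sup>2"
    unfolding sum_divide_distrib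
  proof (intro sum.cong refl)
    fix r assume "r \<in> {1..<l}"
    then have "real (l - r) = real l - r" by (simp add: of_nat_diff)
    then show "(1 - real r / l)\<^sup>2 = (real (l - r))\<^sup>2 / (real l)\<^sup>2" using lp
      by (simp add: power_divide[symmetric] diff_divide_distrib)
  qed
  also have "(\<Sum>r\<in>{1..<l}. (real (l - r))\<^sup>2) = (\<Sum>r<l-1. (real (l - 1 - r))\<^sup>2)"
    by (rule sum.reindex_bij_witness[of _ Suc "\<lambda>r. r - 1"]) auto
  also have "\<dots> = (real l - 1) * l * (2 * l - 1) / 6" using sq[of "l - 1"] assms by (simp add: of_nat_diff)
  also have "\<dots> / (real l)\<^sup>2 \<le> (real l - 1) / 3"
  proof -
    have "(real l - 1) * l * (2 * l - 1) / 6 \<le> (real l - 1) / 3 * (real l)\<^sup>2"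
      using assms by (simp add: power2_eq_square field_simps)
    then show ?thesis using lp by (simp add: divide_le_eq)
  qed
  finally show ?thesis .
qed

section \<open>Overflows\<close>

text \<open>
  \<open>x\<close> and \<open>y\<close> stand for an offline run and an LQD run, and \<open>dropped v i\<close> says that LQD evicts a packet of
  port \<open>i\<close> in step \<open>v\<close>. The last assumption holds because LQD evicts only from longest queues of a full
  buffer.
\<close>

locale two_runs =
  fixes N M :: nat and x y :: "nat \<Rightarrow> nat \<Rightarrow> nat" and dropped :: "nat \<Rightarrow> nat \<Rightarrow> bool"
  assumes M_pos: "0 < M"
    and x_cap: "(\<Sum>i<N. x v i) \<le> M"
    and keep: "i < N \<Longrightarrow> \<not> dropped (Suc v) i \<Longrightarrow> y v i - 1 \<le> y (Suc v) i"
    and lead: "i < N \<Longrightarrow> \<not> dropped (Suc v) i \<Longrightarrow> x (Suc v) i + (y v i - 1) \<le> y (Suc v) i + (x v i - 1)"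
    and lead_0: "i < N \<Longrightarrow> \<not> dropped 0 i \<Longrightarrow> x 0 i \<le> y 0 i"
    and drop_full: "i < N \<Longrightarrow> dropped v i \<Longrightarrow> (\<Sum>k<N. y v k) = M"
    and drop_top: "i < N \<Longrightarrow> dropped v i \<Longrightarrow> k < N \<Longrightarrow> y v k \<le> Suc (y v i)"
    and truncated: "(\<Sum>k<N. min (y v k - 1) h) \<le> (\<Sum>k<N. min (y (Suc v) k) h)"
begin

definition busy :: "nat \<Rightarrow> nat" where
  "busy v = card {i. i < N \<and> 0 < y v i}"

definition idle :: "nat \<Rightarrow> nat" where
  "idle v = card {i. i < N \<and> x v i = 0 \<and> 0 < y v i}"

definition shared :: "nat \<Rightarrow> nat" where
  "shared v = (\<Sum>i<N. min (x v i) (y v i))"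

definition surplus :: "nat \<Rightarrow> nat" where
  "surplus v = (\<Sum>i<N. x v i - y v i)"

definition clock :: "nat \<Rightarrow> nat \<Rightarrow> nat" where
  "clock u t = (\<Sum>v\<in>{u..<t}. busy v)"

definition level :: "nat \<Rightarrow> nat" where
  "level v = Max (y v ` {..<N})"

text \<open>The income, up to the factor \<open>3 / M\<^sup>2\<close>, of a surplus packet in step \<open>v\<close>. The second summand makes up
  for LQD packets whose offline counterpart has already been transmitted or evicted.\<close>

definition gain :: "nat \<Rightarrow> real" where
  "gain v = busy v * (2 * real M - surplus v) + 3/2 * M * idle v"

definition income :: "nat \<Rightarrow> nat \<Rightarrow> real" where
  "income u t = (\<Sum>v\<in>{u..<t}. gain v)"

definition depth :: "nat \<Rightarrow> nat \<Rightarrow> real" where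
  "depth u t = real (t - u + 1) / level u - 1"

lemma shared_surplus: "shared v + surplus v \<le> M"
proof -
  have "shared v + surplus v = (\<Sum>i<N. x v i)"
    unfolding shared_def surplus_def sum.distrib[symmetric] by (intro sum.cong) auto
  then show ?thesis using x_cap[of v] by simp
qed

section \<open>Packets transmitted by LQD after an overflow\<close>

lemma busy_sum: "busy v = (\<Sum>i<N. if 0 < y v i then 1 else 0)"
  by (simp add: busy_def sum.If_cases Int_def)

lemma idle_sum: "idle v = (\<Sum>i<N. if x v i = 0 \<and> 0 < y v i then 1 else 0)"
  by (simp add: idle_def sum.If_cases Int_def)

text \<open>Each step transmits the head of every nonempty queue, and by \<open>truncated\<close>
  the arrivals and evictions that follow never lower the total of the queues cut off at a fixed
  length.\<close>

lemma clock_ge_truncated: "(\<Sum>k<N. min (y v k) h) \<le> clock v (v + h)"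
proof (induction h arbitrary: v)
  case (Suc h)
  have "(\<Sum>k<N. min (y v k) (Suc h)) = (\<Sum>k<N. (if 0 < y v k then 1 else 0) + min (y v k - 1) h)"
    by (intro sum.cong) auto
  also have "\<dots> = busy v + (\<Sum>k<N. min (y v k - 1) h)" by (simp add: sum.distrib busy_sum)
  also have "\<dots> \<le> busy v + clock (Suc v) (Suc v + h)" using truncated[of v h] Suc[of "Suc v"] by linarith
  also have "\<dots> = clock v (v + Suc h)" by (simp add: clock_def sum.atLeast_Suc_lessThan)
  finally show ?case .
qed simp

lemma le_level: "k < N \<Longrightarrow> y v k \<le> level v"
  by (simp add: level_def)

lemma level_drop: "i < N \<Longrightarrow> dropped v i \<Longrightarrow> level v \<le> Suc (y v i)"
  unfolding level_def by (subst Max_le_iff) (auto intro: drop_top)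

lemma level_pos: assumes "i < N" "dropped v i" shows "0 < level v"
proof (rule ccontr)
  assume "\<not> 0 < level v"
  then have "\<forall>k<N. y v k = 0" using le_level[of _ v] by fastforce
  then have "(\<Sum>k<N. y v k) = 0" by simp
  then show False using drop_full[OF assms] M_pos by simp
qed

lemma clock_mono: "u \<le> u' \<Longrightarrow> t' \<le> t \<Longrightarrow> clock u' t' \<le> clock u t"
  unfolding clock_def by (intro sum_mono2) auto

text \<open>Cutting all queues of a full buffer at \<open>h\<close> keeps at least the fraction
  \<open>h / level v\<close> of its \<open>M\<close> packets.\<close>

lemma clock_level:
  assumes "i < N" "dropped v i" "h \<le> level v"
  shows "h * M \<le> level v * clock v (v + h)"
proof -
  have "h * M = (\<Sum>k<N. h * y v k)" 
    unfolding sum_distrib_left[symmetric] drop_full[OF assms(1,2)] ..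
  also have "\<dots> \<le> (\<Sum>k<N. level v * min (y v k) h)"
  proof (intro sum_mono)
    fix k assume "k \<in> {..<N}"
    then have "y v k \<le> level v" by (simp add: le_level)
    then show "h * y v k \<le> level v * min (y v k) h" using assms(3)
      by (cases "y v k \<le> h") (auto simp: min_def mult.commute intro: mult_le_mono)
  qed
  also have "\<dots> \<le> level v * clock v (v + h)"
    unfolding sum_distrib_left[symmetric] using clock_ge_truncated[of v h] by simp
  finally show ?thesis .
qed

lemma clock_full:
  assumes "i < N" "dropped v i" "v + level v \<le> t"
  shows "M \<le> clock v t"
proof -
  have "level v * M \<le> level v * clock v (v + level v)" using clock_level[OF assms(1,2), of "level v"] by simp
  then have "M \<le> clock v (v + level v)" using level_pos[OF assms(1,2)] by simp
  also have "\<dots> \<le> clock v t" using assms(3) by (intro clock_mono) auto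
  finally show ?thesis .
qed

lemma gain_ge: "real (busy v * M) \<le> gain v"
proof -
  have "real (surplus v) \<le> M" using shared_surplus[of v] by linarith
  then have "busy v * real M \<le> busy v * (2 * real M - surplus v)" by (intro mult_left_mono) auto
  moreover have "0 \<le> 3/2 * real M * idle v" by simp
  ultimately show ?thesis unfolding gain_def of_nat_mult by linarith
qed

lemma income_ge_clock: "real (clock u t) * M \<le> income u t"
  unfolding clock_def income_def of_nat_sum sum_distrib_right
  using gain_ge by (intro sum_mono) simp

lemma income_split: "u \<le> v \<Longrightarrow> v \<le> t \<Longrightarrow> income u t = income u v + income v t"
  unfolding income_def by (simp add: sum.atLeastLessThan_concat)

end

text \<open>The induction step of \<open>income_overflow\<close> below: no later overflow \<open>v\<close> yields the claim for \<open>u\<close> by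
  adding up the income before and after \<open>v\<close>.\<close>

locale window = two_runs +
  fixes u t i\<^sub>0 :: nat
  assumes i0: "i\<^sub>0 < N" "dropped u i\<^sub>0"
    and fits: "u + level u \<le> t"
    and short: "2 * clock u t < 3 * M"
    and bad: "u < v \<Longrightarrow> v < t \<Longrightarrow> i < N \<Longrightarrow> dropped v i \<Longrightarrow> v + level v \<le> t \<Longrightarrow>
      clock u v / M + nu (depth v t) < nu (depth u t)"
begin

section \<open>Queues that run empty and their last evictions\<close>

definition death :: "nat \<Rightarrow> nat" where
  "death i = (if \<exists>v. u \<le> v \<and> v < t \<and> y v i = 0 then LEAST v. u \<le> v \<and> y v i = 0 else t)"

text \<open>The last eviction before the queue first becomes empty. A queue that does not become empty before
  \<open>t\<close> is never considered as settled, whence the value \<open>t\<close>.\<close>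

definition join :: "nat \<Rightarrow> nat" where
  "join i = (if death i = t then t
    else if \<exists>s. u < s \<and> s \<le> death i \<and> dropped s i then Max {s. u < s \<and> s \<le> death i \<and> dropped s i}
    else u)"

lemma ut: "u < t" using fits level_pos[OF i0] by linarith

lemma death_dead:
  assumes "u \<le> v" "v < t" "y v i = 0"
  shows "u \<le> death i" "death i \<le> v" "y (death i) i = 0"
proof -
  have d: "death i = (LEAST v. u \<le> v \<and> y v i = 0)" using assms by (auto simp: death_def)
  show "u \<le> death i" "y (death i) i = 0"
    using LeastI[of "\<lambda>v. u \<le> v \<and> y v i = 0" v] assms by (auto simp: d)
  show "death i \<le> v" unfolding d using assms by (intro Least_le) auto
qed

lemma death_range: "u \<le> death i" "death i \<le> t"
proof -
  have "u \<le> death i \<and> death i \<le> t"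
  proof (cases "\<exists>v. u \<le> v \<and> v < t \<and> y v i = 0")
    case True
    then obtain v where "u \<le> v" "v < t" "y v i = 0" by blast
    from death_dead[OF this] \<open>v < t\<close> show ?thesis by linarith
  next
    case False
    then have "death i = t" unfolding death_def by (rule if_not_P)
    then show ?thesis using ut by simp
  qed
  then show "u \<le> death i" "death i \<le> t" by auto
qed

lemma death_zero: assumes "death i < t" shows "y (death i) i = 0"
proof -
  obtain v where "u \<le> v" "v < t" "y v i = 0" using assms by (auto simp: death_def split: if_splits)
  then show ?thesis by (rule death_dead)
qed

lemma busy_before: "u \<le> v \<Longrightarrow> v < death i \<Longrightarrow> 0 < y v i"
proof (rule ccontr)
  assume "u \<le> v" "v < death i" "\<not> 0 < y v i"
  with death_range[of i] have "death i \<le> v" by (intro death_dead(2)) auto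
  with \<open>v < death i\<close> show False by simp
qed

lemma join_alive: "death i = t \<Longrightarrow> join i = t" by (simp add: join_def)

lemma join_cases:
  assumes "death i < t"
  obtains "join i = u" "\<And>s. u < s \<Longrightarrow> s \<le> death i \<Longrightarrow> \<not> dropped s i"
  | "u < join i" "join i \<le> death i" "dropped (join i) i" "\<And>s. join i < s \<Longrightarrow> s \<le> death i \<Longrightarrow> \<not> dropped s i"
proof (cases "\<exists>s. u < s \<and> s \<le> death i \<and> dropped s i")
  case True
  let ?S = "{s. u < s \<and> s \<le> death i \<and> dropped s i}"
  have j: "join i = Max ?S" using True assms by (auto simp: join_def)
  have fin: "finite ?S" by (rule finite_subset[of _ "{..death i}"]) auto
  have "join i \<in> ?S" unfolding j using True fin by (intro Max_in) auto
  then have J: "u < join i" "join i \<le> death i" "dropped (join i) i" by auto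
  have "\<not> dropped s i" if s: "join i < s" "s \<le> death i" for s
  proof
    assume "dropped s i"
    then have "s \<in> ?S" using s J by auto
    from Max_ge[OF fin this] show False using s(1) by (simp add: j)
  qed
  with J show ?thesis by (rule that(2))
next
  case False
  then have "join i = u" unfolding join_def if_not_P[OF False] using assms by simp
  moreover have "\<And>s. u < s \<Longrightarrow> s \<le> death i \<Longrightarrow> \<not> dropped s i" using False by blast
  ultimately show ?thesis by (rule that(1))
qed

lemma join_range: "u \<le> join i" "join i \<le> death i"
proof -
  have "u \<le> join i \<and> join i \<le> death i"
  proof (cases "death i < t")
    case True
    then show ?thesis by (cases rule: join_cases) (use death_range in auto)
  next
    case False
    then show ?thesis using death_range[of i] join_alive[of i] by simp
  qed
  then show "u \<le> join i" "join i \<le> death i" by auto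
qed

lemma dead_if_join_less: "join i < death i \<Longrightarrow> death i < t"
  using death_range[of i] join_alive[of i] by (cases "death i = t") auto

lemma no_drop_after_join:
  assumes "join i \<le> v" "v < death i"
  shows "\<not> dropped (Suc v) i"
proof -
  have d: "death i < t" using dead_if_join_less[of i] assms by simp
  then show ?thesis using join_range[of i] assms by (cases rule: join_cases) auto
qed

text \<open>Without evictions a queue loses at most one packet per step, so it takes at least
  \<open>y v i\<close> steps to become empty.\<close>

lemma decline:
  assumes "i < N" "death i < t" "join i \<le> v" "v \<le> death i"
  shows "y v i + v \<le> death i"
  using assms(4,3)
proof (induction v rule: inc_induct)
  case base
  then show ?case using death_zero[OF assms(2)] by simp
next
  case (step v)
  have "y v i - 1 \<le> y (Suc v) i" using keep[of i v] assms(1) no_drop_after_join[of i v] step by simp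
  then show ?case using step by simp
qed

text \<open>No further eviction hits a settled queue before it first becomes empty. A queue that is
  pending in the window still faces one, or lasts until \<open>t\<close>.\<close>

definition settled :: "nat \<Rightarrow> nat set" where
  "settled v = {i. i < N \<and> join i \<le> v \<and> v < death i}"

definition pending :: "nat \<Rightarrow> nat set" where
  "pending v = {i. i < N \<and> v < join i}"

definition stock :: "nat \<Rightarrow> nat" where
  "stock v = (\<Sum>i\<in>settled v. y v i)"

definition joining :: "nat \<Rightarrow> nat" where
  "joining v = (\<Sum>i | i < N \<and> death i < t \<and> join i = v. y v i)"

lemma finite_settled_pending [simp]: "finite (settled v)" "finite (pending v)" by (auto simp: settled_def pending_def)

lemma settled_pending_disjoint: "settled v \<inter> pending v = {}" by (auto simp: settled_def pending_def)

lemma busy_settled_pending: "u \<le> v \<Longrightarrow> i \<in> settled v \<union> pending v \<Longrightarrow> i < N \<and> 0 < y v i"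
  using busy_before[of v i] join_range[of i] by (auto simp: settled_def pending_def)

lemma card_settled_pending_le: "u \<le> v \<Longrightarrow> card (settled v) + card (pending v) \<le> busy v"
  unfolding busy_def using busy_settled_pending[of v]
  by (subst card_Un_disjoint[symmetric]) (auto simp: settled_pending_disjoint intro!: card_mono)

lemma stock_ge_card: "u \<le> v \<Longrightarrow> card (settled v) \<le> stock v"
proof -
  assume "u \<le> v"
  then have "(\<Sum>i\<in>settled v. 1) \<le> (\<Sum>i\<in>settled v. y v i)" using busy_settled_pending[of v] by (intro sum_mono) fastforce
  then show ?thesis by (simp add: stock_def)
qed

text \<open>A settled queue loses at most one packet per step, and a queue that stops being settled
  is empty, so no other packets disappear from the stock.\<close>

lemma stock_step: "stock v + joining (Suc v) \<le> stock (Suc v) + card (settled v)"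
proof -
  let ?J = "{i. i < N \<and> death i < t \<and> join i = Suc v}"
  have "stock v = (\<Sum>i\<in>settled v. y v i)" by (simp add: stock_def)
  also have "\<dots> \<le> (\<Sum>i\<in>settled v. y (Suc v) i + 1)"
  proof (intro sum_mono)
    fix i assume "i \<in> settled v"
    then have "y v i - 1 \<le> y (Suc v) i"
      using keep[of i v] no_drop_after_join[of i v] by (simp add: settled_def)
    then show "y v i \<le> y (Suc v) i + 1" by simp
  qed
  also have "\<dots> = (\<Sum>i\<in>settled v. y (Suc v) i) + card (settled v)" by (subst sum.distrib) simp
  finally have "stock v + joining (Suc v) \<le> (\<Sum>i\<in>settled v \<union> ?J. y (Suc v) i) + card (settled v)"
    by (subst sum.union_disjoint) (auto simp: joining_def settled_def)
  also have "(\<Sum>i\<in>settled v \<union> ?J. y (Suc v) i) \<le> stock (Suc v)"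
  proof -
    have "(\<Sum>i\<in>settled v \<union> ?J. y (Suc v) i) = (\<Sum>i\<in>(settled v \<union> ?J) \<inter> settled (Suc v). y (Suc v) i)"
    proof (intro sum.mono_neutral_right ballI)
      fix i assume i: "i \<in> settled v \<union> ?J - (settled v \<union> ?J) \<inter> settled (Suc v)"
      then have "death i = Suc v" using join_range[of i] by (auto simp: settled_def)
      moreover have "death i < t" using i dead_if_join_less[of i] by (auto simp: settled_def)
      ultimately show "y (Suc v) i = 0" using death_zero[of i] by simp
    qed auto
    also have "\<dots> \<le> stock (Suc v)" unfolding stock_def by (intro sum_mono2) auto
    finally show ?thesis .
  qed
  finally show ?thesis by simp
qed

lemma settled_last: "settled (t - 1) = {}"
proof -
  have False if "i \<in> settled (t - 1)" for i
  proof -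
    have s: "join i \<le> t - 1" "t - 1 < death i" using that by (auto simp: settled_def)
    then have "death i = t" using death_range[of i] by linarith
    from join_alive[OF this] s ut show False by linarith
  qed
  then show ?thesis by auto
qed

section \<open>Income in terms of settled and pending queues\<close>

definition idle_after :: "nat \<Rightarrow> nat" where
  "idle_after v = (\<Sum>s\<in>{v..<t}. idle s)"

text \<open>An LQD packet that OPT does not mirror is still in the queue when OPT's queue is empty.\<close>

lemma mirror:
  assumes "i < N" "death i < t" "join i \<le> v" "v \<le> death i"
  shows "y v i \<le> x v i + (\<Sum>s\<in>{v..<death i}. if x s i = 0 \<and> 0 < y s i then 1 else 0)"
  using assms(4,3)
proof (induction v rule: inc_induct)
  case base
  then show ?case using death_zero[OF assms(2)] by simp
next
  case (step v)
  let ?e = "\<lambda>s. if x s i = 0 \<and> 0 < y s i then 1 else (0::nat)"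
  have y: "0 < y v i" using busy_before[of v i] step join_range[of i] by simp
  have l: "x (Suc v) i + (y v i - 1) \<le> y (Suc v) i + (x v i - 1)"
    using lead[of i v] assms(1) no_drop_after_join[of i v] step by simp
  have IH: "y (Suc v) i \<le> x (Suc v) i + (\<Sum>s\<in>{Suc v..<death i}. ?e s)" using step by simp
  have s: "(\<Sum>s\<in>{v..<death i}. ?e s) = ?e v + (\<Sum>s\<in>{Suc v..<death i}. ?e s)"
    using step by (simp add: sum.atLeast_Suc_lessThan)
  show ?case unfolding s using l IH y by (cases "x v i = 0") auto
qed

text \<open>Settled packets are handled by \<open>mirror\<close>. A pending queue is nonempty, so it
  either shares a packet with the offline run or is counted in \<open>idle v\<close>.\<close>

lemma shared_ge_stock:
  assumes "u \<le> v" "v < t"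
  shows "stock v + card (pending v) \<le> shared v + idle_after v"
proof -
  let ?e = "\<lambda>s i. if x s i = 0 \<and> 0 < y s i then 1 else (0::nat)"
  have "stock v \<le> (\<Sum>i\<in>settled v. min (x v i) (y v i) + (\<Sum>s\<in>{v..<t}. ?e s i))"
    unfolding stock_def
  proof (intro sum_mono)
    fix i assume "i \<in> settled v"
    then have i: "i < N" "join i \<le> v" "v < death i" by (auto simp: settled_def)
    then have d: "death i < t" using death_range[of i] join_alive[of i] assms by linarith
    have "y v i \<le> x v i + (\<Sum>s\<in>{v..<death i}. ?e s i)" using mirror[of i v] i d by simp
    also have "(\<Sum>s\<in>{v..<death i}. ?e s i) \<le> (\<Sum>s\<in>{v..<t}. ?e s i)"
      using d by (intro sum_mono2) auto
    finally show "y v i \<le> min (x v i) (y v i) + (\<Sum>s\<in>{v..<t}. ?e s i)" by simp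
  qed
  moreover have "card (pending v) \<le> (\<Sum>i\<in>pending v. min (x v i) (y v i) + (\<Sum>s\<in>{v..<t}. ?e s i))"
  proof -
    have "(\<Sum>i\<in>pending v. 1) \<le> (\<Sum>i\<in>pending v. min (x v i) (y v i) + (\<Sum>s\<in>{v..<t}. ?e s i))"
    proof (intro sum_mono)
      fix i assume "i \<in> pending v"
      then have "0 < y v i" using busy_settled_pending[of v i] assms by simp
      then have "1 \<le> min (x v i) (y v i) + ?e v i" by auto
      also have "?e v i \<le> (\<Sum>s\<in>{v..<t}. ?e s i)" using assms by (intro member_le_sum) auto
      finally show "1 \<le> min (x v i) (y v i) + (\<Sum>s\<in>{v..<t}. ?e s i)" by simp
    qed
    then show ?thesis by simp
  qed
  ultimately have "stock v + card (pending v) \<le> (\<Sum>i\<in>settled v \<union> pending v. min (x v i) (y v i) + (\<Sum>s\<in>{v..<t}. ?e s i))"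
    by (subst sum.union_disjoint) (auto simp: settled_pending_disjoint)
  also have "\<dots> \<le> (\<Sum>i<N. min (x v i) (y v i) + (\<Sum>s\<in>{v..<t}. ?e s i))"
    using busy_settled_pending[of v] assms by (intro sum_mono2) auto
  also have "\<dots> = shared v + (\<Sum>i<N. \<Sum>s\<in>{v..<t}. ?e s i)" by (simp add: sum.distrib shared_def)
  also have "(\<Sum>i<N. \<Sum>s\<in>{v..<t}. ?e s i) = idle_after v"
    unfolding idle_after_def idle_sum by (rule sum.swap)
  finally show ?thesis .
qed

lemma income_ge_stock:
  "(\<Sum>v\<in>{u..<t}. real (busy v) * (M + stock v + card (pending v))) \<le> income u t"
proof -
  let ?X = "real (idle_after u)"
  have "(\<Sum>v\<in>{u..<t}. real (busy v) * (M + stock v + card (pending v)))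
      \<le> (\<Sum>v\<in>{u..<t}. real (busy v) * (M + shared v) + ?X * busy v)"
  proof (intro sum_mono)
    fix v assume v: "v \<in> {u..<t}"
    have "idle_after v \<le> idle_after u" unfolding idle_after_def using v by (intro sum_mono2) auto
    then have "stock v + card (pending v) \<le> shared v + idle_after u" using shared_ge_stock[of v] v by simp
    then have "real (M + stock v + card (pending v)) \<le> M + shared v + ?X" by linarith
    then have "real (busy v) * (M + stock v + card (pending v)) \<le> real (busy v) * (M + shared v + ?X)"
      by (intro mult_left_mono) auto
    then show "real (busy v) * (M + stock v + card (pending v)) \<le> real (busy v) * (M + shared v) + ?X * busy v"
      by (simp add: algebra_simps)
  qed
  also have "\<dots> = (\<Sum>v\<in>{u..<t}. real (busy v) * (M + shared v)) + ?X * clock u t"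
    by (simp add: sum.distrib clock_def sum_distrib_left)
  \<comment> \<open>By \<open>short\<close>, the error caused by idle transmissions is covered by
    the summand \<open>3/2 * M * idle v\<close> of \<open>gain\<close>.\<close>
  also have "?X * clock u t \<le> ?X * (3/2 * M)" using short by (intro mult_left_mono) linarith+
  also have "?X * (3/2 * M) = (\<Sum>v\<in>{u..<t}. 3/2 * M * idle v)"
    by (simp add: idle_after_def sum_distrib_left sum_distrib_right algebra_simps)
  also have "(\<Sum>v\<in>{u..<t}. real (busy v) * (M + shared v)) + \<dots> \<le> income u t"
    unfolding income_def sum.distrib[symmetric]
  proof (intro sum_mono)
    fix v
    have "real (M + shared v) \<le> 2 * real M - surplus v" using shared_surplus[of v] by linarith
    then have "real (busy v) * (M + shared v) \<le> busy v * (2 * real M - surplus v)" by (intro mult_left_mono) auto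
    then show "real (busy v) * (M + shared v) + 3/2 * M * idle v \<le> gain v" by (simp add: gain_def)
  qed
  finally show ?thesis by simp
qed

text \<open>The share of queue \<open>i\<close> in the income: in each step before its death it
  receives \<open>M\<close>, plus \<open>busy v\<close> while pending or \<open>busy v / 2\<close>
  once settled.\<close>

definition life :: "nat \<Rightarrow> real" where
  "life i = M * (real (death i) - u) + clock u (join i) + clock (join i) (death i) / 2"

lemma life_sum:
  "(\<Sum>v\<in>{u..<t}. M * real (card (settled v) + card (pending v)) + busy v * (card (settled v) / 2 + card (pending v))) = (\<Sum>i<N. life i)"
proof -
  define f where "f v i = (if i \<in> settled v then M + busy v / 2 else 0) + (if i \<in> pending v then M + real (busy v) else 0)" for v i
  have a: "M * real (card (settled v) + card (pending v)) + busy v * (card (settled v) / 2 + card (pending v)) = (\<Sum>i<N. f v i)" for v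
  proof -
    have "settled v \<subseteq> {..<N}" "pending v \<subseteq> {..<N}" by (auto simp: settled_def pending_def)
    then have "(\<Sum>i<N. f v i) = (\<Sum>i\<in>settled v. M + busy v / 2) + (\<Sum>i\<in>pending v. M + real (busy v))"
      by (simp add: f_def sum.distrib sum.inter_restrict[symmetric] Int_absorb1)
    then show ?thesis by (simp add: algebra_simps)
  qed
  have b: "(\<Sum>v\<in>{u..<t}. f v i) = life i" if "i < N" for i
  proof -
    have "(\<Sum>v\<in>{u..<t}. f v i) = (\<Sum>v\<in>{u..<join i}. f v i) + (\<Sum>v\<in>{join i..<death i}. f v i) + (\<Sum>v\<in>{death i..<t}. f v i)"
      using join_range[of i] death_range[of i] by (simp add: sum.atLeastLessThan_concat)
    also have "(\<Sum>v\<in>{u..<join i}. f v i) = (\<Sum>v\<in>{u..<join i}. M + real (busy v))"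
      using that by (intro sum.cong) (auto simp: f_def settled_def pending_def)
    also have "\<dots> = M * (real (join i) - u) + clock u (join i)"
      using join_range[of i] by (simp add: sum.distrib clock_def of_nat_diff)
    also have "(\<Sum>v\<in>{join i..<death i}. f v i) = (\<Sum>v\<in>{join i..<death i}. M + busy v / 2)"
      using that by (intro sum.cong) (auto simp: f_def settled_def pending_def)
    also have "\<dots> = M * (real (death i) - join i) + clock (join i) (death i) / 2"
      using join_range[of i] by (simp add: sum.distrib clock_def of_nat_diff sum_divide_distrib)
    also have "(\<Sum>v\<in>{death i..<t}. f v i) = 0"
      using join_range[of i] by (intro sum.neutral) (auto simp: f_def settled_def pending_def)
    finally show ?thesis by (simp add: life_def algebra_simps)
  qed
  show ?thesis unfolding a by (subst sum.swap) (simp add: b)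
qed

text \<open>Beyond the lives, the packets in stock leave a quadratic reserve of exactly the form
  that \<open>square_sum\<close> bounds from below.\<close>

lemma income_ge_life:
  "(\<Sum>i<N. life i) + (\<Sum>v\<in>{u..<t}. 2 * real (card (settled v)) * stock v - (real (card (settled v)))\<^sup>2) / 2 \<le> income u t"
proof -
  have "(\<Sum>i<N. life i) + (\<Sum>v\<in>{u..<t}. 2 * real (card (settled v)) * stock v - (real (card (settled v)))\<^sup>2) / 2
    \<le> (\<Sum>v\<in>{u..<t}. real (busy v) * (M + stock v + card (pending v)))"
    unfolding life_sum[symmetric] sum_divide_distrib sum.distrib[symmetric]
  proof (intro sum_mono)
    fix v assume v: "v \<in> {u..<t}"
    define n k r q where "n = real (busy v)" "k = real (card (settled v))" "r = real (card (pending v))" "q = real (stock v)"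
    have "card (settled v) + card (pending v) \<le> busy v" using card_settled_pending_le[of v] v by simp
    then have kn: "k + r \<le> n" by (simp add: n_k_r_q_def)
    have kq: "k \<le> q" using stock_ge_card[of v] v by (simp add: n_k_r_q_def)
    have nn: "0 \<le> k" "0 \<le> r" by (simp_all add: n_k_r_q_def)
    have "(n - k) * k \<le> (n - k) * q" using kn kq nn by (intro mult_left_mono) auto
    moreover have "k * k \<le> n * k" using kn nn by (intro mult_right_mono) auto
    moreover have "M * (k + r) \<le> M * n" using kn by (intro mult_left_mono) auto
    ultimately have "M * (k + r) + n * (k/2 + r) + (2 * k * q - k\<^sup>2)/2 \<le> n * (M + q + r)"
      by (simp add: power2_eq_square field_simps)
    then show "M * real (card (settled v) + card (pending v)) + busy v * (card (settled v) / 2 + card (pending v))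
        + (2 * real (card (settled v)) * stock v - (real (card (settled v)))\<^sup>2) / 2 \<le> real (busy v) * (M + stock v + card (pending v))"
      by (simp add: n_k_r_q_def)
  qed
  then show ?thesis using income_ge_stock by linarith
qed

section \<open>Queues that join the stock after the first overflow\<close>

definition joined :: "nat \<Rightarrow> real" where
  "joined v = (\<Sum>s\<in>{u..<v}. real (joining (Suc s)))"

lemma stock_lower:
  assumes "u \<le> v"
  shows "stock u + joined v - (\<Sum>s\<in>{u..<v}. real (card (settled s))) \<le> stock v"
  using assms
proof (induction v rule: dec_induct)
  case (step v)
  have "real (stock v) + joining (Suc v) \<le> stock (Suc v) + real (card (settled v))" using stock_step[of v] by linarith
  with step show ?case by (simp add: joined_def)
qed (simp add: joined_def)

lemma level_u_pos: "1 \<le> level u" using level_pos[OF i0] by simp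

lemma pending_count_start: "M \<le> stock u + level u * card (pending u)"
proof -
  have "(\<Sum>k<N. y u k) = (\<Sum>k\<in>settled u \<union> pending u. y u k)"
  proof (intro sum.mono_neutral_right ballI)
    fix i assume "i \<in> {..<N} - (settled u \<union> pending u)"
    then have "death i = u" using join_range[of i] by (fastforce simp: settled_def pending_def)
    then show "y u i = 0" using death_zero[of i] ut by simp
  qed (auto simp: settled_def pending_def)
  also have "\<dots> = stock u + (\<Sum>k\<in>pending u. y u k)"
    by (subst sum.union_disjoint) (auto simp: settled_pending_disjoint stock_def)
  also have "(\<Sum>k\<in>pending u. y u k) \<le> (\<Sum>k\<in>pending u. level u)"
    by (intro sum_mono le_level) (auto simp: pending_def)
  finally show ?thesis using drop_full[OF i0] by (simp add: mult.commute)
qed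

lemma depth_u: "level u * (1 + depth u t) = real t - u + 1"
  using level_u_pos ut by (simp add: depth_def of_nat_diff)

text \<open>Makes \<open>bad\<close> applicable at the last eviction from the queue: at least
  \<open>level (join i) - 1\<close> packets are left there, and \<open>death i < t\<close> makes up
  for the missing one.\<close>

lemma joiner:
  assumes "i \<in> pending u" "death i < t"
  shows "u < join i" "join i < t" "i < N" "dropped (join i) i" "level (join i) \<le> Suc (y (join i) i)"
    "join i + y (join i) i \<le> death i" "join i + level (join i) \<le> t"
proof -
  show u: "u < join i" and N: "i < N" using assms(1) by (auto simp: pending_def)
  show d: "dropped (join i) i" using assms(2) u by (cases rule: join_cases) auto
  show "join i < t" using join_range[of i] assms(2) by simp
  show l: "level (join i) \<le> Suc (y (join i) i)" using level_drop[OF N d] .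
  show e: "join i + y (join i) i \<le> death i"
    using decline[OF N assms(2), of "join i"] join_range[of i] by simp
  show "join i + level (join i) \<le> t" using l e assms(2) by linarith
qed

text \<open>A queue lasting until \<open>t\<close> has life at least
  \<open>M * (level u * (1 + m))\<close>. This bounds how far a joining queue falls short of that,
  by \<open>join_loss\<close> scaled with \<open>M\<close>.\<close>

lemma joiner_loss:
  fixes i v :: nat and m :: real
  assumes "i \<in> pending u" "death i < t"
  defines "v \<equiv> join i" and "m \<equiv> min (depth u t) 1"
  shows "level u < level v" "v - u \<le> level u"
    and "M * (level u * (1 + m)) - life i \<le> real (y v i) * (M * m - clock u v) + (real v - u) * (M - M * m)"
proof -
  note J = joiner[OF assms(1,2), folded v_def]
  define a where "a = real (clock u v) / M"
  have Mp: "0 < real M" using M_pos by simp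
  have bad': "a + nu (depth v t) < nu (depth u t)"
    unfolding a_def using bad[OF J(1,2,3,4,7)] .
  have lv: "1 \<le> level v" using level_pos[OF J(3,4)] by simp
  have dv: "0 \<le> depth v t" using J(7) lv by (simp add: depth_def of_nat_diff field_simps)
  have "nu (depth v t) \<ge> 0"
  proof -
    have "(max 0 (1 - depth v t))\<^sup>2 \<le> 1" using dv by (intro power_le_one) auto
    then show ?thesis by (simp add: nu_def)
  qed
  then have a1: "a < 1/2" using bad' nu_le[of "depth u t"] by linarith
  \<comment> \<open>Otherwise LQD would transmit \<open>M\<close> packets between the overflows,
    contradicting \<open>a < 1/2\<close>.\<close>
  show xl: "v - u \<le> level u"
  proof (rule ccontr)
    assume "\<not> v - u \<le> level u"
    then have "M \<le> clock u v" using clock_full[OF i0, of v] by simp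
    then have "1 \<le> a" using Mp by (simp add: a_def)
    then show False using a1 by simp
  qed
  have xa: "real (v - u) / level u \<le> a"
  proof -
    have "(v - u) * M \<le> level u * clock u v" using clock_level[OF i0 xl] J(1) by simp
    then have "real (v - u) * M \<le> level u * real (clock u v)"
      unfolding of_nat_mult[symmetric] of_nat_le_iff .
    then show ?thesis using Mp level_u_pos by (simp add: a_def field_simps)
  qed
  have ht: "t - u - (v - u) = t - v" using J(1,2) by simp
  have yl: "y v i \<le> level v" using le_level[OF J(3)] .
  have l1: "level v \<le> y v i + 1" using J(5) by simp
  have x3: "1 \<le> v - u" "v - u \<le> t - u" using J(1,2) by auto
  have l2: "level v \<le> t - u - (v - u)" unfolding ht using J(7) by simp
  have b2: "a + nu (real (t - u - (v - u) + 1) / real (level v) - 1)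
     < nu (real (t - u + 1) / real (level u) - 1)"
    using bad' unfolding ht depth_def .
  note jl = join_loss[OF level_u_pos lv x3(1) xl x3(2) l2 l1 yl xa b2]
  show "level u < level v" by (rule jl(1))
  have vu: "real (v - u) = real v - u" using J(1) by (simp add: of_nat_diff)
  have L: "level u * (1 + m) - ((real v - u) + y v i + a + y v i / (2 * level v))
      \<le> y v i * (m - a) + (real v - u) * (1 - m)"
    using jl(2) unfolding m_def depth_def vu of_nat_add .
  have "M * (level u * (1 + m) - ((real v - u) + y v i + a + y v i / (2 * level v)))
      \<le> M * (y v i * (m - a) + (real v - u) * (1 - m))"
    using L by (intro mult_left_mono) auto
  moreover have Ma: "M * a = clock u v" using Mp by (simp add: a_def)
  moreover have "M * ((real v - u) + y v i + a + y v i / (2 * level v)) \<le> life i"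
  proof -
    have "y v i * M \<le> level v * clock v (v + y v i)" using clock_level[OF J(3,4) yl] .
    also have "\<dots> \<le> level v * clock v (death i)" using J(6) by (intro mult_left_mono clock_mono) auto
    finally have "real (y v i * M) \<le> real (level v * clock v (death i))" by (rule of_nat_mono)
    then have c: "M * (y v i / (2 * level v)) \<le> clock v (death i) / 2" using lv by (simp add: field_simps)
    have d: "M * ((real v - u) + y v i) \<le> M * (real (death i) - u)" using J(6) by (intro mult_left_mono) linarith+
    have "M * ((real v - u) + y v i + a + y v i / (2 * level v))
      = M * ((real v - u) + y v i) + M * a + M * (y v i / (2 * level v))" by (simp only: distrib_left)
    also have "\<dots> \<le> life i" using c d Ma unfolding life_def v_def by linarith
    finally show ?thesis .
  qed
  moreover have "M * (y v i * (m - a) + (real v - u) * (1 - m))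
     = y v i * (M * m - M * a) + (real v - u) * (M - M * m)" by (simp add: algebra_simps)
  ultimately show "M * (level u * (1 + m)) - life i \<le> real (y v i) * (M * m - clock u v) + (real v - u) * (M - M * m)"
    by (simp add: right_diff_distrib)
qed

text \<open>A queue pending at \<open>u\<close> but no longer at \<open>s\<close> has joined,
  bringing at least \<open>level u\<close> packets:
  \<open>level u < level (join i) \<le> Suc (y (join i) i)\<close>.\<close>

lemma pending_count:
  assumes "u \<le> s" "s < v" "v \<le> t"
  shows "M - real (stock u) - joined (v - 1) \<le> level u * real (card (pending s))"
proof -
  let ?J = "{i\<in>pending u. death i < t \<and> join i < v}"
  have "pending u \<subseteq> pending s \<union> ?J"
  proof
    fix i assume i: "i \<in> pending u"
    show "i \<in> pending s \<union> ?J"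
    proof (cases "join i \<le> s")
      case True
      then have "death i < t" using assms join_alive[of i] death_range[of i] by (cases "death i = t") auto
      then show ?thesis using i True assms by auto
    next
      case False
      then show ?thesis using i by (auto simp: pending_def)
    qed
  qed
  then have "card (pending u) \<le> card (pending s \<union> ?J)" by (intro card_mono) auto
  also have "\<dots> \<le> card (pending s) + card ?J" by (rule card_Un_le)
  finally have "level u * card (pending u) \<le> level u * card (pending s) + level u * card ?J"
    by (simp add: distrib_left[symmetric])
  moreover have "real (level u * card ?J) \<le> joined (v - 1)"
  proof -
    have "level u * card ?J = (\<Sum>i\<in>?J. level u)" by simp
    also have "\<dots> \<le> (\<Sum>i\<in>?J. y (join i) i)"
    proof (intro sum_mono)
      fix i assume "i \<in> ?J"
      then show "level u \<le> y (join i) i" using joiner_loss(1)[of i] joiner(5)[of i] by auto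
    qed
    also have "\<dots> = (\<Sum>s\<in>{u..<v-1}. \<Sum>i\<in>{i\<in>?J. join i - 1 = s}. y (join i) i)"
    proof (rule sum.group[symmetric])
      show "(\<lambda>i. join i - 1) ` ?J \<subseteq> {u..<v - 1}"
      proof clarify
        fix i assume "i \<in> pending u" "death i < t" "join i < v"
        with joiner(1)[of i] show "join i - 1 \<in> {u..<v - 1}" by auto
      qed
    qed auto
    also have "\<dots> \<le> (\<Sum>s\<in>{u..<v-1}. joining (Suc s))"
      unfolding joining_def
    proof (intro sum_mono)
      fix s
      have "(\<Sum>i\<in>{i\<in>?J. join i - 1 = s}. y (join i) i) = (\<Sum>i\<in>{i\<in>?J. join i - 1 = s}. y (Suc s) i)"
        by (intro sum.cong) (auto dest!: joiner(1))
      also have "\<dots> \<le> (\<Sum>i | i < N \<and> death i < t \<and> join i = Suc s. y (Suc s) i)"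
        by (intro sum_mono2) (auto simp: pending_def)
      finally show "(\<Sum>i\<in>{i\<in>?J. join i - 1 = s}. y (join i) i) \<le> \<dots>" .
    qed
    finally have "real (level u * card ?J) \<le> real (\<Sum>s\<in>{u..<v-1}. joining (Suc s))" by (rule of_nat_mono)
    then show ?thesis by (simp add: joined_def)
  qed
  moreover have "real M \<le> stock u + level u * card (pending u)" using pending_count_start by (rule of_nat_mono)
  moreover have "real (level u * card (pending u)) \<le> level u * real (card (pending s)) + real (level u * card ?J)"
    using calculation(1) unfolding of_nat_mult[symmetric] of_nat_add[symmetric] of_nat_le_iff .
  ultimately show ?thesis by simp
qed

text \<open>The clock up to the joining step counts transmissions of settled queues, which lower the
  stock (\<open>stock_lower\<close>), and of pending queues, whose number
  \<open>pending_count\<close> bounds from below.\<close>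

lemma joiner_loss_total:
  fixes i v :: nat and m :: real
  assumes "i \<in> pending u" "death i < t"
  defines "v \<equiv> join i - 1" and "m \<equiv> min (depth u t) 1"
  shows "M * (level u * (1 + m)) - life i
    \<le> real (y (Suc v) i) * ((real (stock v) - card (settled v)) + max 0 (M * m - stock u - joined v))"
proof -
  note J = joiner[OF assms(1,2)]
  note L = joiner_loss[OF assms(1,2), folded m_def]
  have vj: "join i = Suc v" "u \<le> v" using J(1) by (auto simp: v_def)
  define e Kr Kk Y X where "e = real (stock v) - card (settled v)" "Kr = (\<Sum>s\<in>{u..<Suc v}. real (card (pending s)))"
    "Kk = (\<Sum>s\<in>{u..<Suc v}. real (card (settled s)))" "Y = real (y (Suc v) i)" "X = real (Suc v) - u"
  note defs = this
  have e: "stock u + joined v - Kk \<le> e" using stock_lower[OF vj(2)] vj by (simp add: defs)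
  have cl: "Kr + Kk \<le> clock u (Suc v)"
  proof -
    have "(\<Sum>s\<in>{u..<Suc v}. card (settled s) + card (pending s)) \<le> clock u (Suc v)"
      unfolding clock_def by (intro sum_mono card_settled_pending_le) auto
    then have "real (\<Sum>s\<in>{u..<Suc v}. card (settled s) + card (pending s)) \<le> clock u (Suc v)" by (rule of_nat_mono)
    then show ?thesis by (simp add: defs sum.distrib del: sum.op_ivl_Suc)
  qed
  have Kr: "X * (M - real (stock u) - joined v) \<le> level u * Kr"
  proof -
    have "(\<Sum>s\<in>{u..<Suc v}. M - real (stock u) - joined v) \<le> (\<Sum>s\<in>{u..<Suc v}. level u * real (card (pending s)))"
      using pending_count[of _ "Suc v"] J(2) vj by (intro sum_mono) auto
    then show ?thesis using vj by (simp add: defs sum_distrib_left of_nat_diff del: sum.op_ivl_Suc)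
  qed
  have Kr0: "0 \<le> Kr" by (simp add: defs sum_nonneg)
  have Yl: "level u \<le> Y" using L(1) J(5) unfolding vj by (simp add: defs)
  have X0: "0 \<le> X" using vj by (simp add: defs)
  have XY: "X \<le> Y"
  proof -
    have "Suc v - u \<le> level u" using L(2) unfolding vj .
    then have "real (Suc v - u) \<le> level u" by (rule of_nat_mono)
    then show ?thesis using Yl vj by (simp add: defs of_nat_diff)
  qed
  have XKr: "X * (M - real (stock u) - joined v) \<le> Y * Kr"
    using Kr mult_right_mono[OF Yl Kr0] by linarith
  have Y0: "0 \<le> Y" by (simp add: defs)
  define G where "G = M * m - stock u - joined v"
  have "M * (level u * (1 + m)) - life i \<le> Y * (M * m - clock u (Suc v)) + X * (M - M * m)"
    using L(3) unfolding vj by (simp only: defs)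
  also have "Y * (M * m - clock u (Suc v)) \<le> Y * (e + G - Kr)"
    using e cl Y0 by (intro mult_left_mono) (auto simp: G_def)
  \<comment> \<open>\<open>M - M * m\<close> is \<open>(M - stock u - joined v) - G\<close>; the
    first part is covered by \<open>Kr\<close>.\<close>
  also have "Y * (e + G - Kr) + X * (M - M * m) = Y * e + (Y - X) * G + (X * (M - real (stock u) - joined v) - Y * Kr)"
    by (simp add: G_def algebra_simps)
  also have "\<dots> \<le> Y * e + Y * max 0 G"
  proof -
    have "(Y - X) * G \<le> (Y - X) * max 0 G" using XY by (intro mult_left_mono) auto
    also have "\<dots> \<le> Y * max 0 G" using X0 by (intro mult_right_mono) auto
    finally show ?thesis using XKr by linarith
  qed
  finally show ?thesis by (simp add: defs G_def distrib_left)
qed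

text \<open>The queues in \<open>pending u\<close> that survive until \<open>t\<close> have the required \<open>life\<close>. The deficits of the others
  are covered by the growth of \<open>stock\<close> when they join (\<open>square_sum\<close>) up to a remainder bounded by
  \<open>quadratic_greedy\<close>.\<close>

lemma income_window: "(real M)\<^sup>2 * (1 + nu (depth u t)) \<le> income u t"
proof -
  define m where "m = min (depth u t) 1"
  define c where "c = real (stock u)"
  define e where "e v = real (stock v) - card (settled v)" for v
  define j where "j v = real (joining (Suc v))" for v
  let ?J = "{i\<in>pending u. death i < t}"
  let ?B = "M * (level u * (1 + m))"
  have m1: "m \<le> 1" "m \<le> depth u t" by (auto simp: m_def)
  have dep: "0 \<le> 1 + depth u t" using level_u_pos by (simp add: depth_def)
  have m0: "0 \<le> 1 + m" using dep by (simp add: m_def)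
  have sq: "c\<^sup>2 + (\<Sum>v\<in>{u..<t-1}. 2 * e v * j v + (j v)\<^sup>2)
      \<le> (\<Sum>v\<in>{u..<t}. 2 * real (card (settled v)) * stock v - (real (card (settled v)))\<^sup>2)"
  proof -
    have "c\<^sup>2 + (\<Sum>v\<in>{u..<t-1}. 2 * e v * j v + (j v)\<^sup>2)
        \<le> (\<Sum>v\<in>{u..<t-1}. 2 * real (card (settled v)) * real (stock v) - (real (card (settled v)))\<^sup>2) + (real (stock (t-1)))\<^sup>2"
      unfolding c_def e_def j_def
    proof (rule square_sum[where k = "\<lambda>v. real (card (settled v))" and j = "\<lambda>v. real (joining v)"])
      fix v
      show "u \<le> v \<Longrightarrow> real (card (settled v)) \<le> real (stock v)" using stock_ge_card[of v] by simp
      show "real (stock v) - card (settled v) + joining (Suc v) \<le> stock (Suc v)" using stock_step[of v] by linarith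
    qed (use ut in auto)
    \<comment> \<open>Nothing is settled in step \<open>t - 1\<close>, so no final square remains
      and the sum extends to \<open>t\<close>.\<close>
    also have "stock (t-1) = 0" unfolding stock_def settled_last by simp
    also have "(\<Sum>v\<in>{u..<t-1}. 2 * real (card (settled v)) * real (stock v) - (real (card (settled v)))\<^sup>2)
        = (\<Sum>v\<in>{u..<t}. 2 * real (card (settled v)) * stock v - (real (card (settled v)))\<^sup>2)"
    proof (rule sum.mono_neutral_left)
      show "\<forall>i\<in>{u..<t} - {u..<t-1}. 2 * real (card (settled i)) * stock i - (real (card (settled i)))\<^sup>2 = 0"
      proof
        fix i assume "i \<in> {u..<t} - {u..<t-1}"
        then have i: "i = t - 1" by auto
        have "settled i = {}" unfolding i by (rule settled_last)
        then show "2 * real (card (settled i)) * stock i - (real (card (settled i)))\<^sup>2 = 0" by simp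
      qed
    qed auto
    finally show ?thesis by simp
  qed
  have loss: "(\<Sum>i\<in>?J. ?B - life i) \<le> (\<Sum>v\<in>{u..<t-1}. j v * e v + j v * max 0 (M * m - c - joined v))"
  proof -
    have "(\<Sum>i\<in>?J. ?B - life i) = (\<Sum>v\<in>{u..<t-1}. \<Sum>i\<in>{i\<in>?J. join i - 1 = v}. ?B - life i)"
    proof (rule sum.group[symmetric])
      show "(\<lambda>i. join i - 1) ` ?J \<subseteq> {u..<t - 1}"
      proof clarify
        fix i assume "i \<in> pending u" "death i < t"
        with joiner(1,2)[of i] show "join i - 1 \<in> {u..<t - 1}" by auto
      qed
    qed auto
    also have "\<dots> \<le> (\<Sum>v\<in>{u..<t-1}. j v * (e v + max 0 (M * m - c - joined v)))"
    proof (intro sum_mono)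
      fix v
      have eq: "{i\<in>?J. join i - 1 = v} = {i. i < N \<and> death i < t \<and> join i = Suc v}" if "u \<le> v"
        using that by (auto simp: pending_def)
      assume v: "v \<in> {u..<t-1}"
      have "(\<Sum>i\<in>{i\<in>?J. join i - 1 = v}. ?B - life i)
          \<le> (\<Sum>i\<in>{i\<in>?J. join i - 1 = v}. real (y (Suc v) i) * (e v + max 0 (M * m - c - joined v)))"
      proof (intro sum_mono)
        fix i assume "i \<in> {i\<in>?J. join i - 1 = v}"
        then have "i \<in> pending u" "death i < t" "join i - 1 = v" by auto
        then show "?B - life i \<le> real (y (Suc v) i) * (e v + max 0 (M * m - c - joined v))"
          using joiner_loss_total[of i] by (simp add: e_def c_def m_def)
      qed
      also have "\<dots> = j v * (e v + max 0 (M * m - c - joined v))"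
        using eq v by (simp add: sum_distrib_right[symmetric] j_def joining_def)
      finally show "(\<Sum>i\<in>{i\<in>?J. join i - 1 = v}. ?B - life i) \<le> \<dots>" .
    qed
    finally show ?thesis by (simp add: distrib_left)
  qed
  have greedy: "(\<Sum>v\<in>{u..<t-1}. j v * max 0 (M * m - c - joined v) - (j v)\<^sup>2/2) \<le> (M * m - c)\<^sup>2/2"
    using quadratic_greedy[of j "M * m - c" u "t - 1"] by (simp add: j_def joined_def)
  have lifeR: "card (pending u) * ?B - (\<Sum>i\<in>?J. ?B - life i) \<le> (\<Sum>i\<in>pending u. life i)"
  proof -
    have "?B \<le> life i" if "i \<in> pending u - ?J" for i
    proof -
      have d: "death i = t" "join i = t" using that death_range[of i] join_alive[of i] by auto
      have "?B \<le> M * (level u * (1 + depth u t))" using m1 by (intro mult_left_mono) auto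
      also have "\<dots> = M * (real t - u) + M" unfolding depth_u by (simp add: algebra_simps)
      \<comment> \<open>\<open>clock_full\<close> supplies the \<open>M\<close> that stems from the
        \<open>+ 1\<close> in \<open>depth\<close>.\<close>
      finally have "?B \<le> M * (real t - u) + clock u t" using clock_full[OF i0 fits] by simp
      then show ?thesis by (simp add: life_def d clock_def)
    qed
    then have "(\<Sum>i\<in>pending u - ?J. ?B) \<le> (\<Sum>i\<in>pending u - ?J. life i)" by (intro sum_mono) auto
    moreover have "(\<Sum>i\<in>pending u. life i) = (\<Sum>i\<in>pending u - ?J. life i) + (\<Sum>i\<in>?J. life i)"
      by (rule sum.subset_diff) auto
    moreover have "(\<Sum>i\<in>pending u. ?B) = (\<Sum>i\<in>pending u - ?J. ?B) + (\<Sum>i\<in>?J. ?B)"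
      by (rule sum.subset_diff) auto
    ultimately show ?thesis by (simp add: sum_subtractf)
  qed
  have lifeK: "M * c \<le> (\<Sum>i\<in>settled u. life i)"
  proof -
    have "M * c = (\<Sum>i\<in>settled u. M * real (y u i))" by (simp add: c_def stock_def sum_distrib_left)
    also have "\<dots> \<le> (\<Sum>i\<in>settled u. life i)"
    proof (intro sum_mono)
      fix i assume "i \<in> settled u"
      then have i: "i < N" "join i = u" "u < death i" using join_range[of i] by (auto simp: settled_def)
      then have "y u i + u \<le> death i" using decline[of i u] dead_if_join_less[of i] by simp
      then have "M * real (y u i) \<le> M * (real (death i) - u)" by (intro mult_left_mono) linarith+
      then show "M * real (y u i) \<le> life i" by (simp add: life_def)
    qed
    finally show ?thesis .
  qed
  have "(\<Sum>i\<in>settled u \<union> pending u. life i) \<le> (\<Sum>i<N. life i)"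
    by (rule sum_mono2) (use death_range in \<open>auto simp: settled_def pending_def life_def\<close>)
  then have lifes: "(\<Sum>i\<in>settled u. life i) + (\<Sum>i\<in>pending u. life i) \<le> (\<Sum>i<N. life i)"
    by (subst (asm) sum.union_disjoint) (auto simp: settled_pending_disjoint)
  have count: "(M - c) * (M * (1 + m)) \<le> card (pending u) * ?B"
  proof -
    have "real M \<le> c + level u * real (card (pending u))"
      using pending_count_start unfolding c_def of_nat_mult[symmetric] of_nat_add[symmetric] of_nat_le_iff .
    then have "(M - c) * (M * (1 + m)) \<le> (level u * real (card (pending u))) * (M * (1 + m))"
      using m0 by (intro mult_right_mono) auto
    then show ?thesis by (simp add: mult_ac)
  qed
  have split: "(\<Sum>v\<in>{u..<t-1}. j v * e v + j v * max 0 (M * m - c - joined v))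
      = (\<Sum>v\<in>{u..<t-1}. 2 * e v * j v + (j v)\<^sup>2)/2 + (\<Sum>v\<in>{u..<t-1}. j v * max 0 (M * m - c - joined v) - (j v)\<^sup>2/2)"
    unfolding sum_divide_distrib sum.distrib[symmetric] by (intro sum.cong) (auto simp: field_simps)
  have "M * c + (M - c) * (M * (1 + m)) - (M * m - c)\<^sup>2/2 + c\<^sup>2/2 \<le> income u t"
    using income_ge_life lifes lifeK lifeR count loss greedy sq split by linarith
  \<comment> \<open>All terms with \<open>c\<close> cancel, so the amount already settled at
    \<open>u\<close> does not affect the bound.\<close>
  moreover have "M * c + (M - c) * (M * (1 + m)) - (M * m - c)\<^sup>2/2 + c\<^sup>2/2 = (real M)\<^sup>2 * (1 + nu (depth u t))"
    unfolding nu_min m_def[symmetric] by (simp add: power2_eq_square field_simps)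
  ultimately show ?thesis by simp
qed

end

context two_runs
begin

text \<open>Either the clock is so long that \<open>M\<close> per transmission gives
  \<open>3/2 * M\<^sup>2\<close>, the most the claim can ask for; or some later overflow is good
  enough to split the income there and use induction; or the assumptions of \<open>window\<close>
  hold.\<close>

lemma income_overflow:
  assumes "i < N" "dropped u i" "u + level u \<le> t"
  shows "(real M)\<^sup>2 * (1 + nu (depth u t)) \<le> income u t"
  using assms
proof (induction "t - u" arbitrary: u i rule: less_induct)
  case less
  have Mp: "0 < real M" using M_pos by simp
  have nu1: "(real M)\<^sup>2 * (1 + nu r) \<le> M * (3/2 * M)" for r
    using mult_left_mono[of "1 + nu r" "3/2" "(real M)\<^sup>2"] nu_le[of r] by (simp add: power2_eq_square mult_ac)
  consider (long) "3 * M \<le> 2 * clock u t"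
    | (good) v k where "u < v" "v < t" "k < N" "dropped v k" "v + level v \<le> t"
        "nu (depth u t) \<le> clock u v / M + nu (depth v t)"
    | (bad) "2 * clock u t < 3 * M" "\<And>v k. u < v \<Longrightarrow> v < t \<Longrightarrow> k < N \<Longrightarrow> dropped v k \<Longrightarrow> v + level v \<le> t \<Longrightarrow>
        clock u v / M + nu (depth v t) < nu (depth u t)"
    by (meson not_le)
  then show ?case
  proof cases
    case long
    then have "M * (3/2 * M) \<le> M * real (clock u t)" by (intro mult_left_mono) linarith+
    then show ?thesis using nu1[of "depth u t"] income_ge_clock[of u t] by (simp add: mult.commute)
  next
    case (good v k)
    have "(real M)\<^sup>2 * (1 + nu (depth u t)) \<le> (real M)\<^sup>2 * (clock u v / M + (1 + nu (depth v t)))"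
      using good by (intro mult_left_mono) auto
    also have "\<dots> = real (clock u v) * M + (real M)\<^sup>2 * (1 + nu (depth v t))"
      using Mp by (simp add: power2_eq_square field_simps)
    also have "\<dots> \<le> income u v + income v t"
      using less.hyps[of v k] good by (intro add_mono income_ge_clock) auto
    also have "\<dots> = income u t" using good by (intro income_split[symmetric]) auto
    finally show ?thesis .
  next
    case bad
    interpret window N M x y dropped u t i
      by unfold_locales (use less.prems bad in auto)
    show ?thesis by (rule income_window)
  qed
qed

section \<open>Charging\<close>

definition extra :: "nat \<Rightarrow> nat \<Rightarrow> bool" where
  "extra i s \<longleftrightarrow> 0 < x s i \<and> y s i = 0"

text \<open>Without evictions the lead of the offline queue never grows, and every extra
  transmission uses up one packet of it.\<close>

lemma extras_le_lead:
  assumes "i < N" "v \<le> t" "\<And>s. v < s \<Longrightarrow> s \<le> t \<Longrightarrow> \<not> dropped s i"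
  shows "card {s\<in>{v..t}. extra i s} \<le> x v i - y v i"
  using assms(2,3)
proof (induction v rule: inc_induct)
  case base
  have "{s\<in>{t..t}. extra i s} = (if extra i t then {t} else {})" by auto
  then show ?case by (auto simp: extra_def)
next
  case (step v)
  have "x (Suc v) i + (y v i - 1) \<le> y (Suc v) i + (x v i - 1)"
    using lead[OF assms(1), of v] step by simp
  moreover have "card {s\<in>{Suc v..t}. extra i s} \<le> x (Suc v) i - y (Suc v) i" using step by simp
  moreover have "{s\<in>{v..t}. extra i s} = (if extra i v then insert v else id) {s\<in>{Suc v..t}. extra i s}"
    using step by (auto simp: not_less_eq_eq le_less_Suc_eq le_Suc_eq) (metis le_antisym not_less_eq_eq)+
  then have "card {s\<in>{v..t}. extra i s} = (if extra i v then 1 else 0) + card {s\<in>{Suc v..t}. extra i s}" by simp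
  ultimately show ?case by (cases "y v i = 0"; cases "x v i = 0") (auto simp: extra_def)
qed

text \<open>The set is nonempty whenever \<open>extra i t\<close>, see lemma \<open>origin\<close>.\<close>

definition origin :: "nat \<Rightarrow> nat \<Rightarrow> nat" where
  "origin i t = Max {s. s \<le> t \<and> dropped s i}"

text \<open>Had no eviction occurred up to \<open>t\<close>, \<open>lead_0\<close> would leave the
  offline queue without a lead, and \<open>extras_le_lead\<close> would exclude the extra
  transmission.\<close>

lemma origin:
  assumes "i < N" "extra i t"
  shows "origin i t \<le> t" "dropped (origin i t) i" "\<And>s. origin i t < s \<Longrightarrow> s \<le> t \<Longrightarrow> \<not> dropped s i"
proof -
  let ?S = "{s. s \<le> t \<and> dropped s i}"
  have fin: "finite ?S" by (rule finite_subset[of _ "{..t}"]) auto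
  have "?S \<noteq> {}"
  proof
    assume "?S = {}"
    then have nd: "\<not> dropped s i" if "s \<le> t" for s using that by blast
    have "card {s\<in>{0..t}. extra i s} \<le> x 0 i - y 0 i" using assms nd by (intro extras_le_lead) auto
    also have "\<dots> = 0" using lead_0[OF assms(1)] nd by simp
    finally have "{s\<in>{0..t}. extra i s} = {}" by (simp add: card_eq_0_iff)
    then show False using assms(2) by auto
  qed
  then have "origin i t \<in> ?S" unfolding origin_def using fin by (intro Max_in) auto
  then show "origin i t \<le> t" "dropped (origin i t) i" by auto
  show "\<not> dropped s i" if "origin i t < s" "s \<le> t" for s
  proof
    assume "dropped s i"
    then have "s \<le> origin i t" unfolding origin_def using that(2) fin by (intro Max_ge) auto
    then show False using that(1) by simp
  qed
qed

lemma slow_decline: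
  assumes "i < N" "u \<le> s" "\<And>v. u < v \<Longrightarrow> v \<le> s \<Longrightarrow> \<not> dropped v i"
  shows "y u i \<le> y s i + (s - u)"
  using assms(2,3)
proof (induction s rule: dec_induct)
  case (step s)
  have "y s i - 1 \<le> y (Suc s) i" using keep[OF assms(1), of s] step by simp
  with step show ?case by simp
qed simp

definition rank :: "nat \<Rightarrow> nat \<Rightarrow> nat" where
  "rank i t = card {s\<in>{origin i t..t}. extra i s}"

text \<open>At the origin at least \<open>level - 1\<close> packets are left in the LQD queue; they
  delay the first extra transmission by as many steps.\<close>

lemma rank:
  assumes "i < N" "extra i t"
  shows "1 \<le> rank i t" "origin i t + level (origin i t) + rank i t \<le> t + 2"
proof -
  let ?u = "origin i t"
  note O = origin[OF assms]
  have "t \<in> {s\<in>{?u..t}. extra i s}" using O assms by simp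
  then have "rank i t \<noteq> 0" unfolding rank_def by (subst card_0_eq) auto
  then show r: "1 \<le> rank i t" by simp
  have "{s\<in>{?u..t}. extra i s} \<subseteq> {?u + y ?u i..t}"
  proof
    fix s assume s: "s \<in> {s\<in>{?u..t}. extra i s}"
    then have "y ?u i \<le> y s i + (s - ?u)" using O(3) by (intro slow_decline[OF assms(1)]) auto
    then show "s \<in> {?u + y ?u i..t}" using s by (auto simp: extra_def)
  qed
  then have "rank i t \<le> card {?u + y ?u i..t}" unfolding rank_def by (intro card_mono) auto
  then have "?u + y ?u i + rank i t \<le> t + 1" using r by simp
  then show "?u + level ?u + rank i t \<le> t + 2" using level_drop[OF assms(1) O(2)] by simp
qed

section \<open>Income of a single extra transmission\<close>

lemma gain_nonneg: "0 \<le> gain v"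
  using gain_ge[of v] of_nat_0_le_iff[of "busy v * M", where 'a = real] by linarith

text \<open>Equal to \<open>1 - 2 * nu (rank / level)\<close>: what keeps \<open>nu\<close> from its
  maximum.\<close>

definition shortfall :: "nat \<Rightarrow> nat \<Rightarrow> real" where
  "shortfall i t = (max 0 (1 - real (rank i t) / level (origin i t)))\<^sup>2"

lemma extra_income:
  assumes "i < N" "extra i t"
  shows "9/2 * (real M)\<^sup>2 \<le> 3 * (\<Sum>v\<in>{origin i t..t}. gain v) + 3/2 * (real M)\<^sup>2 * shortfall i t"
proof -
  let ?u = "origin i t" and ?r = "rank i t"
  let ?l = "level ?u"
  note O = origin[OF assms] and r = rank[OF assms]
  have lp: "0 < ?l" using level_pos[OF assms(1) O(2)] .
  \<comment> \<open>This end makes the depth \<open>?r / ?l\<close>. It is at most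
    \<open>t + 1\<close>, and \<open>income\<close> omits its end, so only steps up to
    \<open>t\<close> pay.\<close>
  have "(real M)\<^sup>2 * (1 + nu (depth ?u (?u + (?l + ?r - 1)))) \<le> income ?u (?u + (?l + ?r - 1))"
    using r by (intro income_overflow[OF assms(1) O(2)]) auto
  also have "\<dots> \<le> (\<Sum>v\<in>{?u..t}. gain v)"
    unfolding income_def using r lp gain_nonneg by (intro sum_mono2) auto
  also have "depth ?u (?u + (?l + ?r - 1)) = real ?r / ?l"
    using r lp by (simp add: depth_def of_nat_diff add_divide_distrib)
  finally have "(real M)\<^sup>2 * (1 + nu (real ?r / ?l)) \<le> (\<Sum>v\<in>{?u..t}. gain v)" .
  then show ?thesis by (simp add: nu_def shortfall_def algebra_simps)
qed

text \<open>Up to the last such transmission of a port no eviction occurs after \<open>v\<close>, so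
  \<open>extras_le_lead\<close> counts them all against the lead at \<open>v\<close>. Thus each can
  draw on its own surplus packet.\<close>

lemma open_extras_le_surplus:
  "card {(i, t). i < N \<and> t < H \<and> extra i t \<and> origin i t \<le> v \<and> v \<le> t} \<le> surplus v"
proof -
  let ?E = "\<lambda>i. {t. t < H \<and> extra i t \<and> origin i t \<le> v \<and> v \<le> t}"
  have fin: "finite (?E i)" for i by (rule finite_subset[of _ "{..<H}"]) auto
  have "{(i, t). i < N \<and> t < H \<and> extra i t \<and> origin i t \<le> v \<and> v \<le> t} = Sigma {..<N} ?E" by auto
  then have "card {(i, t). i < N \<and> t < H \<and> extra i t \<and> origin i t \<le> v \<and> v \<le> t} = (\<Sum>i<N. card (?E i))"
    using fin by simp
  also have "\<dots> \<le> surplus v"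
    unfolding surplus_def
  proof (intro sum_mono)
    fix i assume "i \<in> {..<N}"
    then have i: "i < N" by simp
    show "card (?E i) \<le> x v i - y v i"
    proof (cases "?E i = {}")
      case False
      define T where "T = Max (?E i)"
      have T: "T \<in> ?E i" unfolding T_def using False fin by (rule Max_in[rotated])
      have "?E i \<subseteq> {s\<in>{v..T}. extra i s}" using Max_ge[OF fin] by (auto simp: T_def)
      then have "card (?E i) \<le> card {s\<in>{v..T}. extra i s}" by (intro card_mono) auto
      also have "\<dots> \<le> x v i - y v i" using T origin(3)[OF i, of T] by (intro extras_le_lead[OF i]) auto
      finally show ?thesis .
    next
      case True
      show ?thesis unfolding True by simp
    qed
  qed
  finally show ?thesis .
qed

section \<open>Summation over all extra transmissions\<close>

definition extras :: "nat \<Rightarrow> (nat \<times> nat) set" where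
  "extras H = {(i, t). i < N \<and> t < H \<and> extra i t}"

lemma finite_extras [simp]: "finite (extras H)"
  by (rule finite_subset[of _ "{..<N} \<times> {..<H}"]) (auto simp: extras_def)

lemma income_total:
  "(\<Sum>(i, t)\<in>extras H. \<Sum>v\<in>{origin i t..t}. gain v) \<le> (\<Sum>v<H. gain v * surplus v)"
proof -
  have "(\<Sum>(i, t)\<in>extras H. \<Sum>v\<in>{origin i t..t}. gain v)
      = (\<Sum>e\<in>extras H. \<Sum>v<H. if origin (fst e) (snd e) \<le> v \<and> v \<le> snd e then gain v else 0)"
  proof (intro sum.cong refl)
    fix e assume "e \<in> extras H"
    then obtain i t where e: "e = (i, t)" "t < H" by (auto simp: extras_def)
    have "(\<Sum>v<H. if origin i t \<le> v \<and> v \<le> t then gain v else 0) = (\<Sum>v\<in>{v\<in>{..<H}. origin i t \<le> v \<and> v \<le> t}. gain v)"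
      by (rule sum.inter_filter[symmetric]) simp
    also have "{v\<in>{..<H}. origin i t \<le> v \<and> v \<le> t} = {origin i t..t}" using e by auto
    finally show "(case e of (i, t) \<Rightarrow> \<Sum>v\<in>{origin i t..t}. gain v)
      = (\<Sum>v<H. if origin (fst e) (snd e) \<le> v \<and> v \<le> snd e then gain v else 0)" by (simp add: e)
  qed
  also have "\<dots> = (\<Sum>v<H. \<Sum>e\<in>extras H. if origin (fst e) (snd e) \<le> v \<and> v \<le> snd e then gain v else 0)"
    by (rule sum.swap)
  also have "\<dots> \<le> (\<Sum>v<H. gain v * surplus v)"
  proof (intro sum_mono)
    fix v
    have "(\<Sum>e\<in>extras H. if origin (fst e) (snd e) \<le> v \<and> v \<le> snd e then gain v else 0)
        = (\<Sum>e\<in>{e\<in>extras H. origin (fst e) (snd e) \<le> v \<and> v \<le> snd e}. gain v)"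
      by (rule sum.inter_filter[symmetric]) simp
    also have "\<dots> = real (card {e\<in>extras H. origin (fst e) (snd e) \<le> v \<and> v \<le> snd e}) * gain v" by simp
    also have "{e\<in>extras H. origin (fst e) (snd e) \<le> v \<and> v \<le> snd e}
        = {(i, t). i < N \<and> t < H \<and> extra i t \<and> origin i t \<le> v \<and> v \<le> t}" by (auto simp: extras_def)
    also have "real (card \<dots>) * gain v \<le> surplus v * gain v"
      using open_extras_le_surplus[of H v] gain_nonneg[of v] by (intro mult_right_mono) auto
    finally show "(\<Sum>e\<in>extras H. if origin (fst e) (snd e) \<le> v \<and> v \<le> snd e then gain v else 0)
      \<le> gain v * surplus v" by (simp add: mult.commute)
  qed
  finally show ?thesis .
qed

definition episodes :: "nat \<Rightarrow> (nat \<times> nat) set" where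
  "episodes H = (\<lambda>(i, t). (i, origin i t)) ` extras H"

text \<open>Transmissions with a common origin have distinct positive ranks, and ranks from
  \<open>level u\<close> on have no shortfall.\<close>

lemma shortfall_episode:
  assumes "(i, u) \<in> episodes H"
  shows "(\<Sum>e\<in>{e\<in>extras H. (fst e, origin (fst e) (snd e)) = (i, u)}. shortfall (fst e) (snd e)) \<le> (real (level u) - 1) / 3"
proof -
  let ?E = "{t. (i, t) \<in> extras H \<and> origin i t = u}"
  obtain t0 where t0: "(i, t0) \<in> extras H" "u = origin i t0" using assms by (auto simp: episodes_def)
  have i: "i < N" using t0 by (auto simp: extras_def)
  have du: "dropped u i" using t0 origin(2)[OF i, of t0] by (auto simp: extras_def)
  have lp: "1 \<le> level u" using level_pos[OF i du] by simp
  have fin: "finite ?E" by (rule finite_subset[of _ "{..<H}"]) (auto simp: extras_def)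
  have inj: "inj_on (rank i) ?E"
  proof (rule linorder_inj_onI)
    fix a b assume ab: "a < b" "a \<in> ?E" "b \<in> ?E"
    have "{s\<in>{u..a}. extra i s} \<subset> {s\<in>{u..b}. extra i s}"
    proof
      show "{s\<in>{u..a}. extra i s} \<subseteq> {s\<in>{u..b}. extra i s}" using ab by auto
      have "b \<in> {s\<in>{u..b}. extra i s}" using ab origin(1)[OF i, of b] by (auto simp: extras_def)
      moreover have "b \<notin> {s\<in>{u..a}. extra i s}" using ab by auto
      ultimately show "{s\<in>{u..a}. extra i s} \<noteq> {s\<in>{u..b}. extra i s}" by blast
    qed
    then have "rank i a < rank i b" using ab unfolding rank_def by (auto intro!: psubset_card_mono)
    then show "rank i a \<noteq> rank i b" by simp
  qed auto
  let ?g = "\<lambda>r. (max 0 (1 - real r / level u))\<^sup>2"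
  have "(\<Sum>e\<in>{e\<in>extras H. (fst e, origin (fst e) (snd e)) = (i, u)}. shortfall (fst e) (snd e)) = (\<Sum>t\<in>?E. ?g (rank i t))"
    by (rule sum.reindex_bij_witness[of _ "\<lambda>t. (i, t)" snd]) (auto simp: shortfall_def)
  also have "\<dots> = (\<Sum>r\<in>rank i ` ?E. ?g r)" using inj by (simp add: sum.reindex)
  also have "\<dots> \<le> (\<Sum>r\<in>{1..<level u} \<union> rank i ` ?E. ?g r)" using fin by (intro sum_mono2) auto
  also have "\<dots> = (\<Sum>r\<in>{1..<level u}. ?g r)"
  proof (intro sum.mono_neutral_right ballI)
    fix r assume r: "r \<in> {1..<level u} \<union> rank i ` ?E - {1..<level u}"
    then have "1 \<le> r" using rank(1)[OF i] by (auto simp: extras_def)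
    then have "level u \<le> r" using r by auto
    then have "1 \<le> real r / level u" using lp by simp
    then show "?g r = 0" by simp
  qed (use fin in auto)
  also have "\<dots> = (\<Sum>r\<in>{1..<level u}. (1 - real r / level u)\<^sup>2)"
    by (intro sum.cong) (auto simp: max_def field_simps)
  also have "\<dots> \<le> (real (level u) - 1) / 3" by (rule sum_complement_squares[OF lp])
  finally show ?thesis .
qed

text \<open>The payments to packets stored by both runs compensate for the shortfalls of all extra
  transmissions with a common origin.\<close>

lemma own_income:
  assumes "(i, u) \<in> episodes H"
  shows "M * (real (level u) - 1) / 2 \<le> (\<Sum>v\<in>{u..<u + (level u - 1)}. real (busy v * y v i))"
proof -
  let ?m = "level u - 1"
  obtain t where t: "(i, t) \<in> extras H" "u = origin i t" using assms by (auto simp: episodes_def)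
  then have i: "i < N" "extra i t" by (auto simp: extras_def)
  note O = origin[OF i, folded t(2)] and r = rank[OF i, folded t(2)]
  have lp: "1 \<le> level u" using level_pos[OF i(1) O(2)] by simp
  have "M * (?m * (?m + 1)) = 2 * (\<Sum>k<?m. Suc k * M)"
  proof -
    have "m * (m + 1) = 2 * (\<Sum>k<m. Suc k)" for m :: nat by (induction m) auto
    then show ?thesis by (simp only: sum_distrib_left[symmetric] mult_ac)
  qed
  \<comment> \<open>Adding up \<open>clock_level\<close> over all shorter windows weights step
    \<open>u + s\<close> by \<open>?m - s\<close>, which is at most the queue length then.\<close>
  also have "\<dots> \<le> 2 * (\<Sum>k<?m. level u * clock u (u + Suc k))"
    by (intro mult_left_mono sum_mono clock_level[OF i(1) O(2)]) auto
  also have "\<dots> = 2 * level u * (\<Sum>k<?m. clock u (u + Suc k))" by (simp only: sum_distrib_left mult.assoc)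
  also have "(\<Sum>k<?m. clock u (u + Suc k)) = (\<Sum>k<?m. \<Sum>s<Suc k. busy (u + s))"
  proof (intro sum.cong refl)
    fix k show "clock u (u + Suc k) = (\<Sum>s<Suc k. busy (u + s))"
      unfolding clock_def
      by (rule sum.reindex_bij_witness[of _ "\<lambda>s. u + s" "\<lambda>s. s - u"]) auto
  qed
  also have "\<dots> = (\<Sum>s<?m. (?m - s) * busy (u + s))" by (rule sum_triangle[symmetric])
  also have "\<dots> \<le> (\<Sum>s<?m. busy (u + s) * y (u + s) i)"
  proof (intro sum_mono)
    fix s assume s: "s \<in> {..<?m}"
    then have "u + s \<le> t" using r by auto
    then have "y u i \<le> y (u + s) i + (u + s - u)" using O(3) by (intro slow_decline[OF i(1)]) auto
    then have "?m - s \<le> y (u + s) i" using level_drop[OF i(1) O(2)] by simp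
    then show "(?m - s) * busy (u + s) \<le> busy (u + s) * y (u + s) i" by (simp add: mult.commute)
  qed
  also have "\<dots> = (\<Sum>v\<in>{u..<u + ?m}. busy v * y v i)"
    by (rule sum.reindex_bij_witness[of _ "\<lambda>v. v - u" "\<lambda>s. u + s"]) auto
  finally have "level u * (M * ?m) \<le> level u * (2 * (\<Sum>v\<in>{u..<u + ?m}. busy v * y v i))"
    using lp by (simp add: mult_ac)
  then have "M * ?m \<le> 2 * (\<Sum>v\<in>{u..<u + ?m}. busy v * y v i)" using lp by simp
  then have "real (M * ?m) \<le> real (2 * (\<Sum>v\<in>{u..<u + ?m}. busy v * y v i))" by (rule of_nat_mono)
  then show ?thesis using lp by (simp add: of_nat_diff)
qed

text \<open>Windows at the same port are disjoint, as no eviction lies between an origin and its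
  extra transmissions. In a window an extra transmission is still to come, so the offline queue is
  longer and every LQD packet of the port is shared.\<close>

lemma own_income_total:
  "(\<Sum>(i, u)\<in>episodes H. \<Sum>v\<in>{u..<u + (level u - 1)}. real (busy v * y v i)) \<le> (\<Sum>v<H. real (busy v * shared v))"
proof -
  let ?W = "\<lambda>e. {snd e..<snd e + (level (snd e) - 1)}"
  let ?f = "\<lambda>(v, i). real (busy v * min (x v i) (y v i))"
  let ?S = "Sigma (episodes H) ?W"
  let ?p = "\<lambda>(e, v). (v, fst e) :: nat \<times> nat"
  have ep: "\<exists>t. u \<le> v \<and> v < t \<and> t < H \<and> i < N \<and> extra i t \<and> origin i t = u"
    if "((i, u), v) \<in> ?S" for i u v
  proof -
    obtain t where t: "(i, t) \<in> extras H" "u = origin i t" using \<open>((i, u), v) \<in> ?S\<close> by (auto simp: episodes_def)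
    then have i: "i < N" "extra i t" by (auto simp: extras_def)
    then show ?thesis using that t rank[OF i] by (intro exI[of _ t]) (auto simp: extras_def)
  qed
  have inj: "inj_on ?p ?S"
  proof -
    have "u = u'" if a: "((i, u), v) \<in> ?S" and b: "((i, u'), v) \<in> ?S" for i u u' v
    proof -
      obtain t where t: "u \<le> v" "v < t" "i < N" "extra i t" "origin i t = u" using ep[OF a] by blast
      obtain t' where t': "u' \<le> v" "v < t'" "extra i t'" "origin i t' = u'" using ep[OF b] by blast
      have "dropped u i" "dropped u' i" using origin(2) t t' by blast+
      then have "\<not> u < u'" "\<not> u' < u" using origin(3)[OF t(3,4), of u'] origin(3)[OF t(3) t'(3), of u] t t' by auto
      then show ?thesis by simp
    qed
    then show ?thesis by (fastforce simp: inj_on_def)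
  qed
  have fin: "finite ?S" by (auto simp: episodes_def)
  have "(\<Sum>(i, u)\<in>episodes H. \<Sum>v\<in>{u..<u + (level u - 1)}. real (busy v * y v i))
      = (\<Sum>(e, v)\<in>?S. real (busy v * y v (fst e)))"
    by (subst sum.Sigma[symmetric]) (auto simp: episodes_def case_prod_beta)
  also have "\<dots> = (\<Sum>q\<in>?S. ?f (?p q))"
  proof (intro sum.cong refl)
    fix q assume q: "q \<in> ?S"
    obtain i u v where qe: "q = ((i, u), v)" by (metis surj_pair)
    obtain t where t: "u \<le> v" "v < t" "i < N" "extra i t" "origin i t = u" using ep q unfolding qe by blast
    have "card {s\<in>{v..t}. extra i s} \<le> x v i - y v i"
      using t origin(3)[OF t(3,4)] by (intro extras_le_lead) auto
    moreover have "card {s\<in>{v..t}. extra i s} \<noteq> 0" using t by (subst card_0_eq) auto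
    ultimately have "y v i \<le> x v i" by linarith
    then show "(case q of (e, v) \<Rightarrow> real (busy v * y v (fst e))) = ?f (?p q)" by (simp add: qe min_absorb2)
  qed
  also have "\<dots> = (\<Sum>q\<in>?p ` ?S. ?f q)" using inj by (simp add: sum.reindex o_def)
  also have "\<dots> \<le> (\<Sum>q\<in>{..<H} \<times> {..<N}. ?f q)"
  proof (intro sum_mono2)
    show "?p ` ?S \<subseteq> {..<H} \<times> {..<N}" using ep by fastforce
  qed auto
  also have "\<dots> = (\<Sum>v<H. real (busy v * shared v))"
    by (simp add: sum.cartesian_product[symmetric] shared_def sum_distrib_left)
  finally show ?thesis .
qed

lemma extras_bound: "54 * card (extras H) \<le> 37 * (\<Sum>v<H. busy v) + 54 * (\<Sum>v<H. idle v)"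
proof -
  let ?M = "real M"
  have "9/2 * ?M\<^sup>2 * card (extras H) = (\<Sum>(i, t)\<in>extras H. 9/2 * ?M\<^sup>2)" by (simp add: case_prod_beta)
  also have "\<dots> \<le> (\<Sum>(i, t)\<in>extras H. 3 * (\<Sum>v\<in>{origin i t..t}. gain v) + 3/2 * ?M\<^sup>2 * shortfall i t)"
    using extra_income by (intro sum_mono) (auto simp: extras_def)
  also have "\<dots> = 3 * (\<Sum>(i, t)\<in>extras H. \<Sum>v\<in>{origin i t..t}. gain v) + 3/2 * ?M\<^sup>2 * (\<Sum>e\<in>extras H. shortfall (fst e) (snd e))"
    by (simp add: case_prod_beta sum.distrib sum_distrib_left)
  also have "\<dots> \<le> 3 * (\<Sum>v<H. gain v * surplus v) + 3/2 * ?M\<^sup>2 * (\<Sum>(i, u)\<in>episodes H. (real (level u) - 1) / 3)"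
  proof (intro add_mono mult_left_mono income_total)
    have "(\<Sum>e\<in>extras H. shortfall (fst e) (snd e))
        = (\<Sum>p\<in>episodes H. \<Sum>e\<in>{e\<in>extras H. (fst e, origin (fst e) (snd e)) = p}. shortfall (fst e) (snd e))"
      by (rule sum.group[symmetric]) (auto simp: episodes_def case_prod_beta)
    also have "\<dots> \<le> (\<Sum>(i, u)\<in>episodes H. (real (level u) - 1) / 3)"
      using shortfall_episode by (intro sum_mono) auto
    finally show "(\<Sum>e\<in>extras H. shortfall (fst e) (snd e)) \<le> (\<Sum>(i, u)\<in>episodes H. (real (level u) - 1) / 3)" .
  qed auto
  also have "3/2 * ?M\<^sup>2 * (\<Sum>(i, u)\<in>episodes H. (real (level u) - 1) / 3)
      = ?M * (\<Sum>(i, u)\<in>episodes H. M * (real (level u) - 1) / 2)"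
    unfolding sum_distrib_left by (intro sum.cong) (auto simp: power2_eq_square)
  also have "\<dots> \<le> ?M * (\<Sum>v<H. real (busy v * shared v))"
  proof (intro mult_left_mono)
    have "(\<Sum>(i, u)\<in>episodes H. M * (real (level u) - 1) / 2)
       \<le> (\<Sum>(i, u)\<in>episodes H. \<Sum>v\<in>{u..<u + (level u - 1)}. real (busy v * y v i))"
      using own_income by (intro sum_mono) auto
    then show "(\<Sum>(i, u)\<in>episodes H. M * (real (level u) - 1) / 2) \<le> (\<Sum>v<H. real (busy v * shared v))"
      using own_income_total[of H] by linarith
  qed simp
  finally have "9/2 * ?M\<^sup>2 * card (extras H)
      \<le> (\<Sum>v<H. 3 * (gain v * surplus v) + ?M * real (busy v * shared v))"
    by (simp add: sum.distrib sum_distrib_left)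
  also have "\<dots> \<le> (\<Sum>v<H. ?M\<^sup>2 * (37/12 * busy v + 9/2 * idle v))"
  proof (intro sum_mono)
    fix v
    define D C n e where "D = real (surplus v)" "C = real (shared v)" "n = real (busy v)" "e = real (idle v)"
    note defs = this
    have CD: "C + D \<le> ?M" using shared_surplus[of v] by (simp add: defs)
    have nn: "0 \<le> C" "0 \<le> D" "0 \<le> n" "0 \<le> e" by (simp_all add: defs)
    \<comment> \<open>This square is 12 times the gap in the following estimate.\<close>
    have "0 \<le> (6 * D - 5 * ?M)\<^sup>2" by simp
    then have "3 * (2 * ?M - D) * D + ?M * (?M - D) \<le> 37/12 * ?M\<^sup>2"
      by (simp add: power2_eq_square field_simps)
    moreover have "?M * C \<le> ?M * (?M - D)" using CD by (intro mult_left_mono) auto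
    ultimately have "3 * (2 * ?M - D) * D + ?M * C \<le> 37/12 * ?M\<^sup>2" by simp
    then have 1: "n * (3 * (2 * ?M - D) * D + ?M * C) \<le> n * (37/12 * ?M\<^sup>2)" using nn by (intro mult_left_mono)
    have "e * (?M * D) \<le> e * (?M * ?M)" using CD nn by (intro mult_left_mono) auto
    then have 2: "9/2 * ?M * e * D \<le> 9/2 * ?M\<^sup>2 * e" by (simp add: power2_eq_square mult_ac)
    have "3 * (gain v * surplus v) + ?M * real (busy v * shared v)
        = n * (3 * (2 * ?M - D) * D + ?M * C) + 9/2 * ?M * e * D"
      by (simp add: gain_def defs algebra_simps)
    also have "\<dots> \<le> ?M\<^sup>2 * (37/12 * n + 9/2 * e)" using 1 2 by (simp add: algebra_simps)
    finally show "3 * (gain v * surplus v) + ?M * real (busy v * shared v) \<le> ?M\<^sup>2 * (37/12 * busy v + 9/2 * idle v)"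
      by (simp only: defs)
  qed
  also have "\<dots> = ?M\<^sup>2 * (37/12 * (\<Sum>v<H. real (busy v)) + 9/2 * (\<Sum>v<H. real (idle v)))"
    by (simp add: sum_distrib_left sum.distrib distrib_left mult_ac)
  finally have "?M\<^sup>2 * (9/2 * card (extras H)) \<le> ?M\<^sup>2 * (37/12 * (\<Sum>v<H. real (busy v)) + 9/2 * (\<Sum>v<H. real (idle v)))"
    by (simp add: mult_ac)
  then have "9/2 * card (extras H) \<le> 37/12 * (\<Sum>v<H. real (busy v)) + 9/2 * (\<Sum>v<H. real (idle v))"
    using M_pos by simp
  then have "real (54 * card (extras H)) \<le> real (37 * (\<Sum>v<H. busy v) + 54 * (\<Sum>v<H. idle v))" by simp
  then show ?thesis unfolding of_nat_le_iff .
qed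

text \<open>The offline run gains the extra transmissions over LQD and loses the idle ones. The
  latter cancel against \<open>extras_bound\<close>, leaving 54 + 37 = 91.\<close>

lemma throughput_bound: "54 * (\<Sum>v<H. card {i. i < N \<and> 0 < x v i}) \<le> 91 * (\<Sum>v<H. busy v)"
proof -
  have "card (extras H) = (\<Sum>v<H. card {i. i < N \<and> extra i v})"
  proof -
    have "card (extras H) = card (Sigma {..<H} (\<lambda>v. {i. i < N \<and> extra i v}))"
      by (rule bij_betw_same_card[of "\<lambda>(i, t). (t, i)"])
        (auto simp: bij_betw_def inj_on_def extras_def image_iff)
    then show ?thesis by simp
  qed
  moreover have "card {i. i < N \<and> 0 < x v i} + idle v = busy v + card {i. i < N \<and> extra i v}" for v
  proof -
    have "card {i. i < N \<and> 0 < x v i} + idle v = card ({i. i < N \<and> 0 < x v i} \<union> {i. i < N \<and> x v i = 0 \<and> 0 < y v i})"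
      unfolding idle_def by (subst card_Un_disjoint) auto
    also have "{i. i < N \<and> 0 < x v i} \<union> {i. i < N \<and> x v i = 0 \<and> 0 < y v i}
        = {i. i < N \<and> 0 < y v i} \<union> {i. i < N \<and> extra i v}" by (auto simp: extra_def)
    also have "card \<dots> = busy v + card {i. i < N \<and> extra i v}"
      unfolding busy_def by (subst card_Un_disjoint) (auto simp: extra_def)
    finally show ?thesis .
  qed
  then have "(\<Sum>v<H. card {i. i < N \<and> 0 < x v i}) + (\<Sum>v<H. idle v) = (\<Sum>v<H. busy v) + (\<Sum>v<H. card {i. i < N \<and> extra i v})"
    unfolding sum.distrib[symmetric] by simp
  ultimately show ?thesis using extras_bound[of H] by simp
qed

end

section \<open>LQD against an offline run\<close>

lemma occupancy_enqueue: "p < N \<Longrightarrow> occupancy N (enqueue p q) = Suc (occupancy N q)"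
  by (simp add: occupancy_def enqueue_def sum.remove[of "{..<N}" p])

lemma occupancy_dequeue: "j < N \<Longrightarrow> 0 < q j \<Longrightarrow> Suc (occupancy N (dequeue j q)) = occupancy N q"
  by (simp add: occupancy_def dequeue_def sum.remove[of "{..<N}" j])

lemma le_occupancy: "i < N \<Longrightarrow> q i \<le> occupancy N q"
  unfolding occupancy_def by (rule member_le_sum) auto

lemma lqd_arrival_cases [consumes 3]:
  assumes "lqd_arrival N M q p q'" "p < N" "occupancy N q \<le> M"
  obtains (accept) "q' = enqueue p q" "occupancy N q < M" "occupancy N q' = Suc (occupancy N q)"
  | (drop) j where "j < N" "\<And>k. k < N \<Longrightarrow> enqueue p q k \<le> enqueue p q j" "q' = dequeue j (enqueue p q)"
      "0 < enqueue p q j" "occupancy N q = M" "occupancy N q' = M"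
proof (cases "occupancy N (enqueue p q) \<le> M")
  case True
  then show thesis using assms by (intro accept) (auto simp: lqd_arrival_def occupancy_enqueue)
next
  case False
  then obtain j where j: "j < N" "\<forall>i<N. enqueue p q i \<le> enqueue p q j" "q' = dequeue j (enqueue p q)"
    using assms(1) by (auto simp: lqd_arrival_def)
  have M: "occupancy N q = M" using False assms by (simp add: occupancy_enqueue)
  have "enqueue p q p \<le> enqueue p q j" using j assms(2) by blast
  then have "0 < enqueue p q j" by (simp add: enqueue_def)
  with j M show thesis
    using occupancy_dequeue[of j N "enqueue p q"] assms(2) by (intro drop[of j]) (auto simp: occupancy_enqueue)
qed

text \<open>At a full buffer every arrival evicts from a longest queue; an arrival that raises the
  maximum makes its own queue the only longest one.\<close>

lemma process_lqd_full:
  assumes "process (lqd_arrival N M) q ps q'" "set ps \<subseteq> {..<N}"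
    and "occupancy N q = M" "\<And>k. k < N \<Longrightarrow> q k \<le> B"
  shows "occupancy N q' = M" "k < N \<Longrightarrow> q' k \<le> B"
proof -
  have "occupancy N q' = M \<and> (\<forall>k<N. q' k \<le> B)"
    using assms
  proof induction
    case (Cons q p q1 ps q')
    have p: "p < N" and ps: "set ps \<subseteq> {..<N}" using Cons.prems by auto
    have "occupancy N q1 = M \<and> (\<forall>k<N. q1 k \<le> B)"
      using Cons.hyps(1) p eq_refl[OF Cons.prems(2)]
    proof (cases rule: lqd_arrival_cases)
      case accept
      then show ?thesis using Cons.prems by simp
    next
      case (drop j)
      have "q1 k \<le> B" if "k < N" for k
      proof (cases "k = j")
        case True
        then show ?thesis using drop(1) Cons.prems(3)[of j] by (auto simp: drop(3) dequeue_def enqueue_def)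
      next
        case False
        then have "q1 k = enqueue p q k" by (simp add: drop(3) dequeue_def)
        moreover have "enqueue p q k \<le> B"
        proof (cases "k = p")
          case True
          then have "enqueue p q k \<le> enqueue p q j" using drop(2) that by blast
          also have "\<dots> = q j" using True False by (simp add: enqueue_def)
          also have "\<dots> \<le> B" using drop(1) Cons.prems(3) by blast
          finally show ?thesis .
        next
          case False
          then show ?thesis using Cons.prems(3)[OF that] by (simp add: enqueue_def)
        qed
        ultimately show ?thesis by simp
      qed
      then show ?thesis using drop by blast
    qed
    then show ?case using Cons.IH[OF ps] by blast
  qed simp
  then show "occupancy N q' = M" "k < N \<Longrightarrow> q' k \<le> B" by auto
qed

text \<open>\<open>Dr\<close> collects the ports evicted from. An eviction leaves its queue at most
  one packet below any other; this persists by \<open>process_lqd_full\<close>, since that queue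
  does not shrink unless it is hit again. At other ports LQD accepts every packet, so the offline
  queue cannot grow more.\<close>

lemma process_drops:
  assumes "process (lqd_arrival N M) q ps q'" "process (offline_arrival N M) p ps r"
    and "set ps \<subseteq> {..<N}" "occupancy N q \<le> M"
  shows "\<exists>Dr. (\<forall>i<N. i \<notin> Dr \<longrightarrow> q i \<le> q' i \<and> r i + q i \<le> q' i + p i) \<and>
    (\<forall>j<N. j \<in> Dr \<longrightarrow> occupancy N q' = M \<and> (\<forall>k<N. q' k \<le> Suc (q' j)))"
  using assms
proof (induction q ps q' arbitrary: p)
  case (Nil q)
  from Nil.prems(1) have "r = p" by cases
  then show ?case by (intro exI[of _ "{}"]) auto
next
  case (Cons q a q1 ps q')
  have a: "a < N" and ps: "set ps \<subseteq> {..<N}" using Cons.prems by auto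
  from Cons.prems(1) obtain p1 where p1: "offline_arrival N M p a p1" "process (offline_arrival N M) p1 ps r"
    by cases
  have p1_le: "p1 i \<le> enqueue a p i" for i using p1(1) by (simp add: offline_arrival_def le_fun_def)
  from Cons.hyps(1) a Cons.prems(3) show ?case
  proof (cases rule: lqd_arrival_cases)
    case accept
    then have "occupancy N q1 \<le> M" by simp
    from Cons.IH[OF p1(2) ps this] obtain Dr where
      Dr: "\<And>i. i < N \<Longrightarrow> i \<notin> Dr \<Longrightarrow> q1 i \<le> q' i \<and> r i + q1 i \<le> q' i + p1 i"
        "\<forall>j<N. j \<in> Dr \<longrightarrow> occupancy N q' = M \<and> (\<forall>k<N. q' k \<le> Suc (q' j))" by metis
    have "q i \<le> q' i \<and> r i + q i \<le> q' i + p i" if "i < N" "i \<notin> Dr" for i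
      using Dr(1)[OF that] p1_le[of i] accept(1) by (auto simp: enqueue_def split: if_splits)
    with Dr(2) show ?thesis by blast
  next
    case (drop j)
    from Cons.IH[OF p1(2) ps eq_refl[OF drop(6)]] obtain Dr where
      Dr: "\<And>i. i < N \<Longrightarrow> i \<notin> Dr \<Longrightarrow> q1 i \<le> q' i \<and> r i + q1 i \<le> q' i + p1 i"
        "\<And>j k. j < N \<Longrightarrow> j \<in> Dr \<Longrightarrow> occupancy N q' = M \<and> (k < N \<longrightarrow> q' k \<le> Suc (q' j))" by metis
    have q1_le: "q1 k \<le> Suc (q1 j)" if "k < N" for k
      using drop(2)[OF that] drop(4) by (auto simp: drop(3) dequeue_def)
    note full = process_lqd_full[OF Cons.hyps(2) ps drop(6) q1_le]
    have "q i \<le> q' i \<and> r i + q i \<le> q' i + p i" if "i < N" "i \<notin> insert j Dr" for i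
      using Dr(1)[OF that(1)] that(2) p1_le[of i] by (auto simp: drop(3) dequeue_def enqueue_def split: if_splits)
    moreover have "occupancy N q' = M \<and> (\<forall>k<N. q' k \<le> Suc (q' i))" if "i < N" "i \<in> insert j Dr" for i
    proof (cases "i \<in> Dr")
      case True
      then show ?thesis using Dr(2)[OF that(1) True] by blast
    next
      case False
      then have "q1 i \<le> q' i" "i = j" using Dr(1)[OF that(1) False] that(2) by auto
      then show ?thesis using full by (meson Suc_le_mono le_trans)
    qed
    ultimately show ?thesis by blast
  qed
qed

text \<open>Evicting from a queue longer than \<open>h\<close> is invisible after truncation. If all
  queues have length at most \<open>h\<close>, nothing is cut off and the total is \<open>M\<close>,
  the largest possible.\<close>

lemma process_lqd_truncated:
  assumes "process (lqd_arrival N M) q ps q'" "set ps \<subseteq> {..<N}" "occupancy N q \<le> M"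
  shows "(\<Sum>k<N. min (q k) h) \<le> (\<Sum>k<N. min (q' k) h)"
  using assms
proof induction
  case (Cons q p q1 ps q')
  have p: "p < N" and ps: "set ps \<subseteq> {..<N}" using Cons.prems by auto
  from Cons.hyps(1) p Cons.prems(2)
  have "(\<Sum>k<N. min (q k) h) \<le> (\<Sum>k<N. min (q1 k) h) \<and> occupancy N q1 \<le> M"
  proof (cases rule: lqd_arrival_cases)
    case accept
    have "(\<Sum>k<N. min (q k) h) \<le> (\<Sum>k<N. min (q1 k) h)"
      by (intro sum_mono) (auto simp: accept(1) enqueue_def)
    with accept show ?thesis by simp
  next
    case (drop j)
    have "(\<Sum>k<N. min (q k) h) \<le> (\<Sum>k<N. min (q1 k) h)"
    proof (cases "enqueue p q j \<le> h")
      case True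
      have "enqueue p q k \<le> h" if "k < N" for k using drop(2)[OF that] True by linarith
      then have "q1 k \<le> h" if "k < N" for k using that by (auto simp: drop(3) dequeue_def intro: le_trans[OF diff_le_self])
      then have "(\<Sum>k<N. min (q1 k) h) = occupancy N q1" unfolding occupancy_def by (intro sum.cong) auto
      moreover have "(\<Sum>k<N. min (q k) h) \<le> occupancy N q" unfolding occupancy_def by (intro sum_mono) auto
      ultimately show ?thesis using drop by simp
    next
      case False
      then show ?thesis by (intro sum_mono) (auto simp: drop(3) dequeue_def enqueue_def)
    qed
    with drop show ?thesis by simp
  qed
  then show ?case using Cons.IH[OF ps] by auto
qed simp

lemma phase_drops:
  assumes "lqd_phase N M q ps q'" "offline_phase N M p ps p'" "set ps \<subseteq> {..<N}" "occupancy N q \<le> M"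
  shows "\<exists>Dr. (\<forall>i<N. i \<notin> Dr \<longrightarrow> q i \<le> q' i \<and> p' i + q i \<le> q' i + p i) \<and>
    (\<forall>j<N. j \<in> Dr \<longrightarrow> occupancy N q' = M \<and> (\<forall>k<N. q' k \<le> Suc (q' j)))"
proof -
  obtain r where r: "process (offline_arrival N M) p ps r" "p' \<le> r"
    using assms(2) by (auto simp: offline_phase_def)
  have le: "p' i \<le> r i" for i using r(2) by (simp add: le_fun_def)
  obtain Dr where Dr: "\<forall>i<N. i \<notin> Dr \<longrightarrow> q i \<le> q' i \<and> r i + q i \<le> q' i + p i"
      "\<forall>j<N. j \<in> Dr \<longrightarrow> occupancy N q' = M \<and> (\<forall>k<N. q' k \<le> Suc (q' j))"
    using process_drops[OF assms(1)[unfolded lqd_phase_def] r(1) assms(3,4)] by blast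
  have "q i \<le> q' i \<and> p' i + q i \<le> q' i + p i" if "i < N" "i \<notin> Dr" for i
    using Dr(1)[rule_format, OF that] le[of i] by auto
  with Dr(2) show ?thesis by blast
qed

lemma offline_phase_capacity:
  assumes "offline_phase N M q ps q'" "occupancy N q \<le> M"
  shows "occupancy N q' \<le> M"
proof -
  obtain r where r: "process (offline_arrival N M) q ps r" "q' \<le> r"
    using assms(1) by (auto simp: offline_phase_def)
  have "occupancy N r \<le> M" using r(1) assms(2) by induction (auto simp: offline_arrival_def)
  moreover have "occupancy N q' \<le> occupancy N r"
    using r(2) by (auto simp: occupancy_def le_fun_def intro: sum_mono)
  ultimately show ?thesis by simp
qed

lemma occupancy_transmit_le: "occupancy N (transmit q) \<le> occupancy N q"
  using occupancy_transmit[of N q] by simp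

lemma offline_run_capacity:
  assumes "offline_run N M I x"
  shows "occupancy N (x t) \<le> M"
proof (induction t)
  case 0
  show ?case
    by (rule offline_phase_capacity[of N M "\<lambda>_. 0" "I 0"]) (use assms in \<open>auto simp: is_run_def occupancy_def\<close>)
next
  case (Suc t)
  show ?case
  proof (rule offline_phase_capacity)
    show "offline_phase N M (transmit (x t)) (I (Suc t)) (x (Suc t))" using assms by (simp add: is_run_def)
    show "occupancy N (transmit (x t)) \<le> M" using occupancy_transmit_le Suc by (rule order_trans)
  qed
qed

text \<open>The buffer on entering a step, so that step 0 needs no separate treatment.\<close>

definition before :: "(nat \<Rightarrow> buffer) \<Rightarrow> nat \<Rightarrow> buffer" where
  "before b t = (case t of 0 \<Rightarrow> \<lambda>_. 0 | Suc s \<Rightarrow> transmit (b s))"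

lemma run_phase: "is_run phase I b \<Longrightarrow> phase (before b t) (I t) (b t)"
  by (auto simp: is_run_def before_def split: nat.split)

lemma two_runs_of_instance:
  assumes I: "valid_instance N I" and x: "offline_run N M I x" and b: "lqd_run N M I b" and "0 < M"
  obtains dropped where "two_runs N M x b dropped"
proof -
  have cap: "occupancy N (x t) \<le> M" "occupancy N (b t) \<le> M" for t
    using offline_run_capacity[OF x] offline_run_capacity[OF lqd_run_offline[OF b]] by auto
  have before_cap: "occupancy N (before b t) \<le> M" for t
    using order_trans[OF occupancy_transmit_le cap(2)] by (auto simp: before_def occupancy_def split: nat.split)
  have ps: "set (I t) \<subseteq> {..<N}" for t using I by (simp add: valid_instance_def)
  obtain Dr where Dr: "\<And>t i. i < N \<Longrightarrow> i \<notin> Dr t \<Longrightarrow> before b t i \<le> b t i \<and> x t i + before b t i \<le> b t i + before x t i"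
    "\<And>t i k. i < N \<Longrightarrow> i \<in> Dr t \<Longrightarrow> occupancy N (b t) = M \<and> (k < N \<longrightarrow> b t k \<le> Suc (b t i))"
    using phase_drops[OF run_phase[OF b] run_phase[OF x] ps before_cap] by metis
  show thesis
  proof (rule that[of "\<lambda>t i. i \<in> Dr t"], unfold_locales)
    fix v i k h
    show "0 < M" by fact
    show "(\<Sum>i<N. x v i) \<le> M" using cap(1)[of v] by (simp add: occupancy_def)
    show "b v i - 1 \<le> b (Suc v) i" if "i < N" "i \<notin> Dr (Suc v)"
      using Dr(1)[OF that] by (simp add: before_def transmit_def)
    show "x (Suc v) i + (b v i - 1) \<le> b (Suc v) i + (x v i - 1)" if "i < N" "i \<notin> Dr (Suc v)"
      using Dr(1)[OF that] by (simp add: before_def transmit_def)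
    show "x 0 i \<le> b 0 i" if "i < N" "i \<notin> Dr 0"
      using Dr(1)[OF that] by (simp add: before_def)
    show "(\<Sum>k<N. b v k) = M" if "i < N" "i \<in> Dr v"
      using Dr(2)[OF that] by (simp add: occupancy_def)
    show "b v k \<le> Suc (b v i)" if "i < N" "i \<in> Dr v" "k < N"
      using Dr(2)[OF that(1,2)] that(3) by blast
    show "(\<Sum>k<N. min (b v k - 1) h) \<le> (\<Sum>k<N. min (b (Suc v) k) h)"
      using process_lqd_truncated[OF run_phase[OF b, of "Suc v", unfolded lqd_phase_def] ps before_cap, of h]
      by (simp add: before_def transmit_def)
  qed
qed

section \<open>Throughput up to a finite horizon\<close>

lemma transmissions_before:
  "transmissions N b \<inter> {..<H} \<times> UNIV = Sigma {..<H} (\<lambda>v. {i. i < N \<and> 0 < b v i})"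
  by (auto simp: transmissions_def)

lemma throughput_le:
  assumes I: "valid_instance N I" and x: "offline_run N M I x" and b: "lqd_run N M I b"
  shows "54 * throughput N x \<le> 91 * throughput N b"
proof (cases "M = 0")
  case True
  have "x t i = 0" if "i < N" for t i
    using offline_run_capacity[OF x, of t] le_occupancy[OF that, of "x t"] True by simp
  then have "transmissions N x = {}" by (auto simp: transmissions_def)
  then show ?thesis by (simp add: throughput_def)
next
  case False
  then obtain dropped where "two_runs N M x b dropped" using two_runs_of_instance[OF I x b] by blast
  then interpret two_runs N M x b dropped .
  have fin: "finite (transmissions N x)" "finite (transmissions N b)"
    using offline_run_transmissions(1)[OF I] x lqd_run_offline[OF b] by blast+
  \<comment> \<open>All offline transmissions occur before \<open>H\<close>; later ones of LQD only
    strengthen the inequality.\<close>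
  obtain H where H: "\<forall>s\<in>fst ` transmissions N x. s < H"
    using finite_nat_set_iff_bounded fin(1) by (metis finite_imageI)
  have "transmissions N x = transmissions N x \<inter> {..<H} \<times> UNIV" using H by auto
  also have "\<dots> = Sigma {..<H} (\<lambda>v. {i. i < N \<and> 0 < x v i})" by (rule transmissions_before)
  finally have "throughput N x = (\<Sum>v<H. card {i. i < N \<and> 0 < x v i})" by (simp add: throughput_def)
  moreover have "(\<Sum>v<H. busy v) = card (transmissions N b \<inter> {..<H} \<times> UNIV)"
    by (simp add: transmissions_before busy_def)
  then have "(\<Sum>v<H. busy v) \<le> throughput N b"
    unfolding throughput_def using fin(2) by (simp add: card_mono)
  ultimately show ?thesis using throughput_bound[of H] by simp
qed

theorem theorem1:
  fixes N M :: nat and I :: arrivals and b :: "nat \<Rightarrow> buffer"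
  assumes "valid_instance N I"
    and "lqd_run N M I b"
  shows "real (opt N M I) \<le> 1.6918 * real (throughput N b)"
proof -
  have "opt N M I \<in> {throughput N x |x. offline_run N M I x}"
    unfolding opt_def
    by (intro Max_in finite_offline_throughputs offline_throughputs_nonempty assms(1))
  then obtain x where "offline_run N M I x" "opt N M I = throughput N x" by blast
  then have "54 * opt N M I \<le> 91 * throughput N b" using throughput_le assms by simp
  then have "real (54 * opt N M I) \<le> real (91 * throughput N b)" by (rule of_nat_mono)
  \<comment> \<open>91/54 is about 1.6852.\<close>
  then show ?thesis by simp
qed

end
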